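(* Assume $f$ is $L$-smooth and the generalized heavy-tailed noise assumption holds with $\alpha\in(1,2]$, $\sigma_0,\sigma_1\ge0$. Let $K\ge1$, $\eta>0$, $\beta\in(0,1)$ and batch size $B>\big(2\sqrt\pi(1+\sqrt{d_0})\mathcal C_\alpha^{1/\alpha}\sigma_1\big)^{\alpha/(\alpha-1)}$, and put $\rho:=1-(1+\sqrt{d_0})\,2\sqrt\pi\,\mathcal C_\alpha^{1/\alpha}\sigma_1/B^{(\alpha-1)/\alpha}>0$, $\Gamma_\alpha:=(2^\alpha+1)^{1/\alpha}$. Then Muon with exact polar decomposition satisfies $$\min_{0\le k\le K-1}\mathbb E\|\nabla f({\bm{X}}_k)\|_F\le\frac{f({\bm{X}}_0)-f_\star}{\eta\rho K}+\frac{Ld_0\eta}{2\rho}+(1+\sqrt{d_0})\frac{\mathbb E\|{\bm{S}}_0\|_F}{(1-\beta)K\rho}+\frac{\beta^2}{(1-\beta)\rho}L\eta\sqrt{d_0}(1+\sqrt{d_0})+(1+\sqrt{d_0})\frac{2\sqrt\pi\,\mathcal C_\alpha^{1/\alpha}}{\rho B^{(\alpha-1)/\alpha}}\Gamma_\alpha\sigma_0(1-\beta)^{\frac{\alpha-1}{\alpha}}+(1+\sqrt{d_0})\frac{2\sqrt\pi\,\mathcal C_\alpha^{1/\alpha}\sigma_1\|\nabla f({\bm{X}}_0)\|_F}{\rho B^{(\alpha-1)/\alpha}K}.$$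
   Context: Norms on $\mathbb{R}^{m\times n}$: $\|\cdot\|_F$ Frobenius; $d_0:=\min\{m,n\}$. $f:\mathbb{R}^{m\times n}\to\mathbb R$ is differentiable with $f\ge f_\star>-\infty$; $L$-smooth means $\|\nabla f({\bm{X}})-\nabla f({\bm{Y}})\|_F\le L\|{\bm{X}}-{\bm{Y}}\|_F$. Muon: given $\beta\in(0,1)$, $\eta>0$, $B\in\mathbb N$, initial ${\bm{X}}_0,{\bm{C}}_{-1}$, for $k=0,1,\dots$: ${\bm{G}}_k=\frac1B\sum_{i=1}^B{\bm{G}}_k^i$, ${\bm{C}}_k=\beta{\bm{C}}_{k-1}+{\bm{G}}_k$, ${\bm{M}}_k=\beta{\bm{C}}_k+{\bm{G}}_k$, ${\bm{X}}_{k+1}={\bm{X}}_k-\eta\mathcal T({\bm{M}}_k)$, with exact polar decomposition $\mathcal T({\bm{M}})={\bm{U}}{\bm{V}}^\top$ for a compact SVD ${\bm{M}}={\bm{U}}\bm\Sigma{\bm{V}}^\top$ ($\mathcal T(\mathbf 0)=\mathbf 0$). $\widetilde{{\bm{M}}}_k:=(1-\beta){\bm{M}}_k$, ${\bm{S}}_k:=\widetilde{{\bm{M}}}_k-\nabla f({\bm{X}}_k)$. $\mathcal F_k$ is the $\sigma$-field of all randomness up to the beginning of iteration $k$ (${\bm{X}}_k$ is $\mathcal F_k$-measurable, ${\bm{G}}_k^i$ are $\mathcal F_{k+1}$-measurable). Generalized heavy-tailed noise assumption: for every $k$, conditionally on $\mathcal F_k$, ${\bm{G}}_k^1,\dots,{\bm{G}}_k^B$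 are independent, $\mathbb E[{\bm{G}}_k^i\mid\mathcal F_k]=\nabla f({\bm{X}}_k)$, and $\mathbb E[\|{\bm{G}}_k^i-\nabla f({\bm{X}}_k)\|_F^\alpha\mid\mathcal F_k]\le\sigma_0^\alpha+\sigma_1^\alpha\|\nabla f({\bm{X}}_k)\|_F^\alpha$. $\mathcal C_\alpha\in(0,2]$ is a constant depending only on $\alpha$ such that for any finitely many independent mean-zero random elements ${\bm{Y}}_i$ of a real Hilbert space with finite $\alpha$-th moments, $\mathbb E\|\sum_i{\bm{Y}}_i\|^\alpha\le\mathcal C_\alpha\sum_i\mathbb E\|{\bm{Y}}_i\|^\alpha$. *)

theory Defs
  imports "HOL-Probability.Probability"
begin

definition outer :: "real^'m \<Rightarrow> real^'n \<Rightarrow> real^'n^'m" where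
  "outer u v = (\<chi> a b. u $ a * v $ b)"

(* Q = U V^T for a compact SVD M = U Sigma V^T, written as sums of rank-one terms *)
definition is_polar_factor :: "real^'n^'m \<Rightarrow> real^'n^'m \<Rightarrow> bool" where
  "is_polar_factor M Q \<longleftrightarrow>
     (\<exists>(r::nat) (u::nat \<Rightarrow> real^'m) (v::nat \<Rightarrow> real^'n) (s::nat \<Rightarrow> real).
        (\<forall>i<r. \<forall>j<r. u i \<bullet> u j = (if i = j then 1 else 0)) \<and>
        (\<forall>i<r. \<forall>j<r. v i \<bullet> v j = (if i = j then 1 else 0)) \<and>
        (\<forall>i<r. s i > 0) \<and>
        M = (\<Sum>i<r. s i *\<^sub>R outer (u i) (v i)) \<and>
        Q = (\<Sum>i<r. outer (u i) (v i)))"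

(* exact polar factor T(M) (well defined since U V^T does not depend on the compact SVD) *)
definition polar :: "real^'n^'m \<Rightarrow> real^'n^'m" where
  "polar M = (SOME Q. is_polar_factor M Q)"

definition batch_mean :: "(nat \<Rightarrow> nat \<Rightarrow> 'w \<Rightarrow> real^'n^'m) \<Rightarrow> nat \<Rightarrow> nat \<Rightarrow> 'w \<Rightarrow> real^'n^'m" where
  "batch_mean G B k w = (1 / real B) *\<^sub>R (\<Sum>i\<in>{1..B}. G k i w)"

(* muon_Cprev beta Cm1 Gb k = C_{k-1} *)
primrec muon_Cprev :: "real \<Rightarrow> real^'n^'m \<Rightarrow> (nat \<Rightarrow> real^'n^'m) \<Rightarrow> nat \<Rightarrow> real^'n^'m" where
  "muon_Cprev \<beta> Cm1 Gb 0 = Cm1"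
| "muon_Cprev \<beta> Cm1 Gb (Suc k) = \<beta> *\<^sub>R muon_Cprev \<beta> Cm1 Gb k + Gb k"

definition muon_C :: "real \<Rightarrow> real^'n^'m \<Rightarrow> (nat \<Rightarrow> real^'n^'m) \<Rightarrow> nat \<Rightarrow> real^'n^'m" where
  "muon_C \<beta> Cm1 Gb k = \<beta> *\<^sub>R muon_Cprev \<beta> Cm1 Gb k + Gb k"

definition muon_M :: "real \<Rightarrow> real^'n^'m \<Rightarrow> (nat \<Rightarrow> real^'n^'m) \<Rightarrow> nat \<Rightarrow> real^'n^'m" where
  "muon_M \<beta> Cm1 Gb k = \<beta> *\<^sub>R muon_C \<beta> Cm1 Gb k + Gb k"

primrec muon_X :: "real \<Rightarrow> real \<Rightarrow> real^'n^'m \<Rightarrow> real^'n^'m \<Rightarrow> (nat \<Rightarrow> real^'n^'m) \<Rightarrow> nat \<Rightarrow> real^'n^'m" where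
  "muon_X \<eta> \<beta> X0 Cm1 Gb 0 = X0"
| "muon_X \<eta> \<beta> X0 Cm1 Gb (Suc k) = muon_X \<eta> \<beta> X0 Cm1 Gb k - \<eta> *\<^sub>R polar (muon_M \<beta> Cm1 Gb k)"

(* the constant C_alpha: von Bahr--Esseen type inequality for independent mean-zero
   random elements of the Hilbert space real^'n^'m *)
definition vbe_constant :: "real \<Rightarrow> real \<Rightarrow> ('n::finite) itself \<Rightarrow> ('m::finite) itself \<Rightarrow> bool" where
  "vbe_constant \<alpha> C (_::'n itself) (_::'m itself) \<longleftrightarrow>
     (\<forall>(Q::(nat \<Rightarrow> real^'n^'m) measure) (Y::nat \<Rightarrow> (nat \<Rightarrow> real^'n^'m) \<Rightarrow> real^'n^'m) (N::nat).
        prob_space Q \<longrightarrow>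
        prob_space.indep_vars Q (\<lambda>_. borel) Y {..<N} \<longrightarrow>
        (\<forall>i<N. integrable Q (Y i) \<and> (\<integral>x. Y i x \<partial>Q) = 0 \<and>
               (\<integral>\<^sup>+x. ennreal (norm (Y i x) powr \<alpha>) \<partial>Q) < \<infinity>) \<longrightarrow>
        (\<integral>\<^sup>+x. ennreal (norm (\<Sum>i<N. Y i x) powr \<alpha>) \<partial>Q)
          \<le> ennreal C * (\<Sum>i<N. \<integral>\<^sup>+x. ennreal (norm (Y i x) powr \<alpha>) \<partial>Q))"

end

theory Submission
  imports Defs
begin

text \<open>
  Along the iterates the descent lemma together with
  \<open>\<langle>M, polar M\<rangle> \<ge> norm M\<close> and \<open>norm (polar M) \<le> sqrt d\<close> (where \<open>d = min m n\<close>) gives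
  \<open>f (X (k+1)) \<le> f (X k) - \<eta> \<parallel>\<nabla>f (X k)\<parallel> + \<eta> (1 + sqrt d) \<parallel>S k\<parallel> + L d \<eta>\<^sup>2 / 2\<close>,
  so only the momentum errors \<open>S k\<close> have to be summed. Unrolling the recursion, \<open>S k\<close> is a
  geometrically damped \<open>S 0\<close>, plus a drift of size \<open>\<beta>\<^sup>2 L \<eta> sqrt d / (1 - \<beta>)\<close>, plus a weighted sum
  of the noises of all samples seen so far.

  The noise sum is a martingale. With \<open>x\<close> the sum so far and \<open>y\<close> one further sample,
  \<open>\<parallel>x + y\<parallel>\<^sup>\<alpha> \<le> \<parallel>x\<parallel>\<^sup>\<alpha> + \<alpha> \<parallel>x\<parallel>\<^bsup>\<alpha>-2\<^esup> \<langle>x, y\<rangle> + 3\<^sup>\<alpha> \<parallel>y\<parallel>\<^sup>\<alpha>\<close> controls the conditional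
  \<open>\<alpha>\<close>-th moment, the samples of one batch being processed one after the other. Because the
  conditional moment bound is itself random, the estimate is iterated for the potential
  \<open>(A + \<parallel>x\<parallel>\<^sup>\<alpha>)\<^bsup>1/\<alpha>\<^esup>\<close>: by concavity each step adds the deterministic \<open>\<sigma>0\<close> part to \<open>A\<close> and
  splits off the \<open>\<sigma>1\<close> part linearly in the gradient norm. The resulting constant \<open>3\<close> is at most
  \<open>2 sqrt \<pi> C\<^bsup>1/\<alpha>\<^esup>\<close>, since every von Bahr--Esseen constant \<open>C\<close> is at least \<open>1\<close>.
\<close>

section \<open>Singular values and the polar factor\<close>

definition orthonormal_on :: "'i set \<Rightarrow> ('i \<Rightarrow> 'a::real_inner) \<Rightarrow> bool" where
  "orthonormal_on I u \<longleftrightarrow> (\<forall>i\<in>I. \<forall>j\<in>I. u i \<bullet> u j = (if i = j then 1 else 0))"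

lemma orthonormal_on_inner:
  "orthonormal_on I u \<Longrightarrow> i \<in> I \<Longrightarrow> j \<in> I \<Longrightarrow> u i \<bullet> u j = (if i = j then 1 else 0)"
  by (simp add: orthonormal_on_def)

lemma inner_sum_orthonormal_on:
  assumes "orthonormal_on I u" "finite I" "j \<in> I"
  shows "u j \<bullet> (\<Sum>i\<in>I. c i *\<^sub>R u i) = c j"
proof -
  have "u j \<bullet> (\<Sum>i\<in>I. c i *\<^sub>R u i) = (\<Sum>i\<in>I. if i = j then c i else 0)"
    unfolding inner_sum_right using assms by (intro sum.cong) (auto simp: orthonormal_on_inner)
  then show ?thesis
    using assms by simp
qed

lemma card_orthonormal_on_le_DIM:
  fixes u :: "'i \<Rightarrow> 'a::euclidean_space"
  assumes "orthonormal_on I u"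
  shows "card I \<le> DIM('a)"
proof -
  have "inj_on u I"
    using assms by (intro inj_onI) (metis orthonormal_on_inner zero_neq_one)
  moreover have "independent (u ` I)"
  proof (rule pairwise_orthogonal_independent)
    show "pairwise orthogonal (u ` I)"
      unfolding pairwise_def orthogonal_def using assms by (auto simp: orthonormal_on_inner)
    show "0 \<notin> u ` I"
      using assms by (metis imageE inner_zero_left orthonormal_on_inner zero_neq_one)
  qed
  ultimately show ?thesis
    by (metis card_image independent_bound)
qed

lemma inner_outer: "M \<bullet> outer u v = u \<bullet> (M *v v)"
  unfolding outer_def inner_vec_def matrix_vector_mult_def
  by (simp add: sum_distrib_left mult.assoc mult.left_commute mult.commute)

lemma outer_mult_vec: "outer u v *v x = (v \<bullet> x) *\<^sub>R u"
  unfolding outer_def inner_vec_def matrix_vector_mult_def vec_eq_iff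
  by (simp add: sum_distrib_left mult.assoc mult.left_commute mult.commute)

lemma outer_inner_outer: "outer u v \<bullet> outer u' v' = (u \<bullet> u') * (v \<bullet> v')"
  by (simp add: inner_outer outer_mult_vec inner_commute)

definition outer_sum ::
  "nat \<Rightarrow> (nat \<Rightarrow> real^'m) \<Rightarrow> (nat \<Rightarrow> real) \<Rightarrow> (nat \<Rightarrow> real^'n) \<Rightarrow> real^'n^'m" where
  "outer_sum r u t v = (\<Sum>i<r. t i *\<^sub>R outer (u i) (v i))"

lemma outer_sum_mult_vec: "outer_sum r u t v *v x = (\<Sum>i<r. (t i * (v i \<bullet> x)) *\<^sub>R u i)"
  unfolding outer_sum_def
  by (induction r)
    (auto simp: matrix_vector_mult_add_rdistrib scaleR_matrix_vector_assoc[symmetric] outer_mult_vec)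

lemma transpose_outer_sum: "transpose (outer_sum r u t v) = outer_sum r v t u"
  unfolding outer_sum_def outer_def transpose_def vec_eq_iff by (simp add: mult.commute)

lemma inner_outer_sum:
  assumes "orthonormal_on {..<r} u" "orthonormal_on {..<r} v"
  shows "outer_sum r u t v \<bullet> outer_sum r u t' v = (\<Sum>i<r. t i * t' i)"
proof -
  have "outer_sum r u t v \<bullet> outer_sum r u t' v = (\<Sum>i<r. \<Sum>j<r. if j = i then t i * t' j else 0)"
    unfolding outer_sum_def inner_sum_left inner_sum_right using assms
    by (intro sum.cong) (auto simp: orthonormal_on_inner outer_inner_outer)
  then show ?thesis
    by simp
qed

definition compact_svd ::
  "nat \<Rightarrow> (nat \<Rightarrow> real^'m) \<Rightarrow> (nat \<Rightarrow> real) \<Rightarrow> (nat \<Rightarrow> real^'n) \<Rightarrow> real^'n^'m \<Rightarrow> bool" where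
  "compact_svd r u s v M \<longleftrightarrow>
     orthonormal_on {..<r} u \<and> orthonormal_on {..<r} v \<and> (\<forall>i<r. 0 < s i) \<and> M = outer_sum r u s v"

lemma is_polar_factor_iff_compact_svd:
  "is_polar_factor M Q \<longleftrightarrow> (\<exists>r u s v. compact_svd r u s v M \<and> Q = outer_sum r u (\<lambda>_. 1) v)"
  unfolding is_polar_factor_def compact_svd_def outer_sum_def orthonormal_on_def
    Ball_def lessThan_iff scaleR_one by blast

lemma compact_svd_mult_vec:
  assumes "compact_svd r u s v M" "i < r"
  shows "M *v v i = s i *\<^sub>R u i" and "u i \<bullet> (M *v x) = s i * (v i \<bullet> x)"
proof -
  have M: "M = outer_sum r u s v" and u: "orthonormal_on {..<r} u" and v: "orthonormal_on {..<r} v"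
    using assms(1) by (auto simp: compact_svd_def)
  have "M *v v i = (\<Sum>j<r. if j = i then s j *\<^sub>R u j else 0)"
    unfolding M outer_sum_mult_vec using v assms(2)
    by (intro sum.cong) (auto simp: orthonormal_on_inner)
  then show "M *v v i = s i *\<^sub>R u i"
    using assms(2) by simp
  show "u i \<bullet> (M *v x) = s i * (v i \<bullet> x)"
    unfolding M outer_sum_mult_vec using inner_sum_orthonormal_on[OF u] assms(2) by simp
qed

lemma exists_norm_matrix_vector_maximizer:
  fixes M :: "real^'n^'m"
  obtains v where "norm v = 1" "\<And>x. norm (M *v x) \<le> norm (M *v v) * norm x"
proof -
  have "continuous_on (sphere (0::real^'n) 1) (\<lambda>x. norm (M *v x))"
    by (intro continuous_intros)
  then obtain v where v: "norm v = 1" and max: "\<And>x. norm x = 1 \<Longrightarrow> norm (M *v x) \<le> norm (M *v v)"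
    using continuous_attains_sup[OF compact_sphere, of 0 1 "\<lambda>x. norm (M *v x)"] by auto
  have "norm (M *v x) \<le> norm (M *v v) * norm x" for x
  proof (cases "x = 0")
    case False
    then have "norm (M *v ((1 / norm x) *\<^sub>R x)) \<le> norm (M *v v)"
      by (intro max) simp
    then show ?thesis
      using False by (simp add: matrix_vector_mult_scaleR field_simps)
  qed simp
  with v show ?thesis
    by (rule that)
qed

lemma exists_singular_pair:
  fixes M :: "real^'n^'m"
  assumes "M \<noteq> 0"
  obtains u v s where "norm u = 1" "norm v = 1" "0 < s" "M *v v = s *\<^sub>R u" "u v* M = s *\<^sub>R v"
proof -
  obtain v where v: "norm v = 1" and max: "\<And>x. norm (M *v x) \<le> norm (M *v v) * norm x"
    using exists_norm_matrix_vector_maximizer[of M] by blast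
  define s where "s = norm (M *v v)"
  define u where "u = (1 / s) *\<^sub>R (M *v v)"
  obtain x where "M *v x \<noteq> 0"
    using assms matrix_eq[of M 0] by auto
  then have "0 < s"
    using max[of x] by (auto simp: s_def)
  then have u: "norm u = 1" and Mv: "M *v v = s *\<^sub>R u"
    by (auto simp: u_def s_def)
  define a where "a = u v* M"
  have inner_a: "a \<bullet> x = u \<bullet> (M *v x)" for x
    unfolding a_def by (rule dot_lmul_matrix)
  have "norm a * norm a = u \<bullet> (M *v a)"
    by (simp add: inner_a[symmetric] dot_square_norm power2_eq_square)
  also have "\<dots> \<le> s * norm a"
    using norm_cauchy_schwarz[of u "M *v a"] max[of a] u by (simp add: s_def)
  finally have "norm a \<le> s"
    using \<open>0 < s\<close> by (cases "a = 0") auto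
  moreover have "a \<bullet> v = s"
    using u by (simp add: inner_a Mv dot_square_norm)
  ultimately have "norm a = s" and "a \<bullet> v = norm a * norm v"
    using v norm_cauchy_schwarz[of a v] by auto
  then have "a = s *\<^sub>R v"
    using v norm_cauchy_schwarz_eq[of a v] by simp
  with u v \<open>0 < s\<close> Mv that show ?thesis
    unfolding a_def by blast
qed

lemma dim_kernel_deflation_less:
  fixes M :: "real^'n^'m"
  assumes "norm u = 1" "norm v = 1" "0 < s" "M *v v = s *\<^sub>R u" "u v* M = s *\<^sub>R v"
  shows "dim {x. M *v x = 0} < dim {x. (M - s *\<^sub>R outer u v) *v x = 0}"
proof -
  have deflated: "(M - s *\<^sub>R outer u v) *v x = M *v x - (s * (v \<bullet> x)) *\<^sub>R u" for x
    by (simp add: matrix_vector_mult_diff_rdistrib scaleR_matrix_vector_assoc[symmetric] outer_mult_vec)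
  have "v \<bullet> x = 0" if "M *v x = 0" for x
    using dot_lmul_matrix[of u M x] that assms(3,5) by simp
  then have "{x. M *v x = 0} \<subseteq> {x. (M - s *\<^sub>R outer u v) *v x = 0}"
    by (auto simp: deflated)
  moreover have "(M - s *\<^sub>R outer u v) *v v = 0" "M *v v \<noteq> 0"
    using assms by (auto simp: deflated dot_square_norm)
  moreover have "subspace {x. A *v x = 0}" for A :: "real^'n^'m"
    by (auto simp: subspace_def matrix_vector_right_distrib matrix_vector_mult_scaleR)
  ultimately show ?thesis
    by (intro dim_psubset) (auto simp: span_eq_iff[THEN iffD2])
qed

lemma compact_svd_Suc:
  assumes svd: "compact_svd r u s v M"
    and "norm u' = 1" "norm v' = 1" "0 < s'" and kernel: "M *v v' = 0" "u' v* M = 0"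
  shows "compact_svd (Suc r) (u(r := u')) (s(r := s')) (v(r := v')) (M + s' *\<^sub>R outer u' v')"
proof -
  have orthogonal: "u i \<bullet> u' = 0" "v i \<bullet> v' = 0" if "i < r" for i
  proof -
    have "0 < s i"
      using svd that by (simp add: compact_svd_def)
    then show "u i \<bullet> u' = 0" "v i \<bullet> v' = 0"
      using compact_svd_mult_vec(1)[OF svd that] dot_lmul_matrix[of u' M "v i"]
        compact_svd_mult_vec(2)[OF svd that, of v'] kernel
      by (auto simp: inner_commute)
  qed
  have "orthonormal_on {..<Suc r} (u(r := u'))" "orthonormal_on {..<Suc r} (v(r := v'))"
    using svd orthogonal norm_eq_1[of u'] norm_eq_1[of v'] assms(2,3)
    by (auto simp: compact_svd_def orthonormal_on_def less_Suc_eq inner_commute)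
  then show ?thesis
    using svd \<open>0 < s'\<close> by (auto simp: compact_svd_def outer_sum_def less_Suc_eq)
qed

lemma exists_compact_svd:
  fixes M :: "real^'n^'m"
  shows "\<exists>r u s v. compact_svd r u s v M"
proof (induction "CARD('n) - dim {x. M *v x = 0}" arbitrary: M rule: less_induct)
  case less
  show ?case
  proof (cases "M = 0")
    case True
    then have "compact_svd 0 (\<lambda>_. 0) (\<lambda>_. 0) (\<lambda>_. 0) M"
      by (simp add: compact_svd_def orthonormal_on_def outer_sum_def)
    then show ?thesis
      by blast
  next
    case False
    then obtain u\<^sub>0 v\<^sub>0 s\<^sub>0 where pair: "norm u\<^sub>0 = 1" "norm v\<^sub>0 = 1" "0 < s\<^sub>0"
      "M *v v\<^sub>0 = s\<^sub>0 *\<^sub>R u\<^sub>0" "u\<^sub>0 v* M = s\<^sub>0 *\<^sub>R v\<^sub>0"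
      by (rule exists_singular_pair)
    define M' where "M' = M - s\<^sub>0 *\<^sub>R outer u\<^sub>0 v\<^sub>0"
    have "dim {x. M *v x = 0} < dim {x. M' *v x = 0}" "dim {x. M' *v x = 0} \<le> CARD('n)"
      using dim_kernel_deflation_less[OF pair] dim_subset_UNIV[of "{x. M' *v x = 0}"]
      by (auto simp: M'_def)
    then have "CARD('n) - dim {x. M' *v x = 0} < CARD('n) - dim {x. M *v x = 0}"
      by linarith
    then obtain r u s v where svd: "compact_svd r u s v M'"
      using less by blast
    have mult: "M' *v x = M *v x - (s\<^sub>0 * (v\<^sub>0 \<bullet> x)) *\<^sub>R u\<^sub>0" for x
      by (simp add: M'_def matrix_vector_mult_diff_rdistrib scaleR_matrix_vector_assoc[symmetric]
          outer_mult_vec)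
    have "(u\<^sub>0 v* M') \<bullet> x = 0" for x
      using pair dot_lmul_matrix[of u\<^sub>0 M x]
      by (simp add: dot_lmul_matrix mult inner_diff_right dot_square_norm)
    then have "u\<^sub>0 v* M' = 0"
      using inner_eq_zero_iff by blast
    moreover have "M' *v v\<^sub>0 = 0"
      using pair by (simp add: mult dot_square_norm)
    ultimately have "compact_svd (Suc r) (u(r := u\<^sub>0)) (s(r := s\<^sub>0)) (v(r := v\<^sub>0))
        (M' + s\<^sub>0 *\<^sub>R outer u\<^sub>0 v\<^sub>0)"
      using compact_svd_Suc[OF svd pair(1-3)] by blast
    then show ?thesis
      unfolding M'_def diff_add_cancel by blast
  qed
qed

lemma polar_compact_svdE:
  obtains r u s v where "compact_svd r u s v M" "polar M = outer_sum r u (\<lambda>_. 1) v"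
proof -
  have "is_polar_factor M (polar M)"
    unfolding polar_def
    by (rule someI_ex) (use exists_compact_svd[of M] in \<open>auto simp: is_polar_factor_iff_compact_svd\<close>)
  then show ?thesis
    using that by (auto simp: is_polar_factor_iff_compact_svd)
qed

lemma norm_polar_le: "norm (polar M :: real^'n^'m) \<le> sqrt (real (min CARD('m) CARD('n)))"
proof -
  obtain r u s v where svd: "compact_svd r u s v M" and polar: "polar M = outer_sum r u (\<lambda>_. 1) v"
    by (rule polar_compact_svdE)
  have "r \<le> CARD('m)" "r \<le> CARD('n)"
    using svd card_orthonormal_on_le_DIM[of "{..<r}" u] card_orthonormal_on_le_DIM[of "{..<r}" v]
    by (auto simp: compact_svd_def)
  moreover have "(norm (polar M))\<^sup>2 = r"
    using svd unfolding power2_norm_eq_inner polar by (simp add: inner_outer_sum compact_svd_def)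
  ultimately show ?thesis
    by (intro real_le_rsqrt) auto
qed

lemma norm_le_inner_polar: "norm M \<le> M \<bullet> polar M"
proof -
  obtain r u s v where svd: "compact_svd r u s v M" and polar: "polar M = outer_sum r u (\<lambda>_. 1) v"
    by (rule polar_compact_svdE)
  then have M: "M = outer_sum r u s v"
    by (simp add: compact_svd_def)
  have "norm M \<le> (\<Sum>i<r. norm (s i *\<^sub>R outer (u i) (v i)))"
    unfolding M outer_sum_def by (rule norm_sum)
  also have "\<dots> = (\<Sum>i<r. s i * 1)"
    using svd by (intro sum.cong)
      (auto simp: norm_eq_sqrt_inner outer_inner_outer orthonormal_on_inner compact_svd_def)
  also have "\<dots> = M \<bullet> polar M"
    using svd unfolding polar by (subst M) (simp add: inner_outer_sum compact_svd_def)
  finally show ?thesis .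
qed

text \<open>
  The Newton--Schulz iteration keeps the singular vectors and drives all singular values of
  \<open>M / norm M\<close> to \<open>1\<close>. Hence every polar factor of \<open>M\<close> is its limit, which makes \<open>polar\<close> a
  limit of continuous functions although it is defined by choice.
\<close>

definition newton_schulz_step :: "real^'n^'m \<Rightarrow> real^'n^'m" where
  "newton_schulz_step Y = (3/2) *\<^sub>R Y - (1/2) *\<^sub>R (Y ** transpose Y ** Y)"

definition newton_schulz_scalar :: "real \<Rightarrow> real" where
  "newton_schulz_scalar t = 3/2 * t - t ^ 3 / 2"

lemma newton_schulz_step_outer_sum:
  assumes "orthonormal_on {..<r} u" "orthonormal_on {..<r} v"
  shows "newton_schulz_step (outer_sum r u t v) = outer_sum r u (\<lambda>i. newton_schulz_scalar (t i)) v"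
proof -
  define Y where "Y = outer_sum r u t v"
  have "Y ** transpose Y ** Y = outer_sum r u (\<lambda>i. t i ^ 3) v"
    unfolding matrix_eq
  proof
    fix x
    have "Y ** transpose Y ** Y *v x = Y *v (transpose Y *v (Y *v x))"
      by (simp add: matrix_vector_mul_assoc matrix_mul_assoc)
    also have "\<dots> = outer_sum r u (\<lambda>i. t i ^ 3) v *v x"
      unfolding Y_def transpose_outer_sum outer_sum_mult_vec
      using inner_sum_orthonormal_on[OF assms(1)] inner_sum_orthonormal_on[OF assms(2)]
      by (intro sum.cong) (auto simp: power3_eq_cube)
    finally show "Y ** transpose Y ** Y *v x = outer_sum r u (\<lambda>i. t i ^ 3) v *v x" .
  qed
  then show ?thesis
    by (simp add: newton_schulz_step_def newton_schulz_scalar_def flip: Y_def)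
      (simp add: Y_def outer_sum_def scaleR_sum_right sum_subtractf[symmetric] scaleR_diff_left)
qed

lemma funpow_newton_schulz_step_outer_sum:
  assumes "orthonormal_on {..<r} u" "orthonormal_on {..<r} v"
  shows "(newton_schulz_step ^^ n) (outer_sum r u t v)
    = outer_sum r u (\<lambda>i. (newton_schulz_scalar ^^ n) (t i)) v"
  by (induction n) (simp_all add: newton_schulz_step_outer_sum[OF assms])

lemma newton_schulz_scalar_contraction:
  assumes "0 < t" "t \<le> x" "x \<le> 1"
  shows "t \<le> newton_schulz_scalar x" and "newton_schulz_scalar x \<le> 1"
    and "1 - newton_schulz_scalar x \<le> (1 - x) * (1 - t/2)"
proof -
  have "0 \<le> x\<^sup>2" "x\<^sup>2 \<le> 1"
    using assms by (simp_all add: power_le_one)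
  have gain: "newton_schulz_scalar x = x + x * (1 - x\<^sup>2) / 2"
    by (simp add: newton_schulz_scalar_def power2_eq_square power3_eq_cube field_simps)
  have "0 \<le> x * (1 - x\<^sup>2) / 2"
    using assms \<open>x\<^sup>2 \<le> 1\<close> by simp
  then show "t \<le> newton_schulz_scalar x"
    unfolding gain using assms by linarith
  have error: "1 - newton_schulz_scalar x = (1 - x) * (1 - (x + x\<^sup>2) / 2)"
    by (simp add: newton_schulz_scalar_def power2_eq_square power3_eq_cube field_simps)
  have "0 \<le> (1 - x) * (1 - (x + x\<^sup>2) / 2)"
    using assms \<open>x\<^sup>2 \<le> 1\<close> by simp
  then show "newton_schulz_scalar x \<le> 1"
    using error by linarith
  show "1 - newton_schulz_scalar x \<le> (1 - x) * (1 - t/2)"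
    unfolding error using assms \<open>0 \<le> x\<^sup>2\<close> by (intro mult_left_mono) (simp_all add: add_increasing2)
qed

lemma funpow_newton_schulz_scalar_tendsto_1:
  assumes "0 < t" "t \<le> 1"
  shows "(\<lambda>n. (newton_schulz_scalar ^^ n) t) \<longlonglongrightarrow> 1"
proof -
  let ?x = "\<lambda>n. (newton_schulz_scalar ^^ n) t"
  have bounds: "t \<le> ?x n \<and> ?x n \<le> 1 \<and> 1 - ?x n \<le> (1 - t/2) ^ n" for n
  proof (induction n)
    case 0
    then show ?case
      using assms by simp
  next
    case (Suc n)
    then have IH: "t \<le> ?x n" "?x n \<le> 1" "1 - ?x n \<le> (1 - t/2) ^ n"
      by auto
    note contraction = newton_schulz_scalar_contraction[OF assms(1) IH(1,2)]
    have "(1 - ?x n) * (1 - t/2) \<le> (1 - t/2) ^ Suc n"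
      using IH(3) assms unfolding power_Suc2 by (intro mult_right_mono) auto
    with contraction(3) have "1 - ?x (Suc n) \<le> (1 - t/2) ^ Suc n"
      unfolding funpow.simps comp_def by (rule order_trans)
    then show ?case
      using contraction(1,2) by simp
  qed
  have "(\<lambda>n. (1 - t/2) ^ n) \<longlonglongrightarrow> 0"
    using assms by (intro LIMSEQ_realpow_zero) auto
  then have lower: "(\<lambda>n. 1 - (1 - t/2) ^ n) \<longlonglongrightarrow> 1"
    using tendsto_diff[OF tendsto_const] by fastforce
  show ?thesis
    by (rule tendsto_sandwich[OF _ _ lower tendsto_const])
      (use bounds in \<open>auto simp: algebra_simps intro!: always_eventually\<close>)
qed

lemma newton_schulz_tendsto_polar: "(\<lambda>n. (newton_schulz_step ^^ n) ((1 / norm M) *\<^sub>R M)) \<longlonglongrightarrow> polar M"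
proof -
  obtain r u s v where svd: "compact_svd r u s v M" and polar: "polar M = outer_sum r u (\<lambda>_. 1) v"
    by (rule polar_compact_svdE)
  then have u: "orthonormal_on {..<r} u" and v: "orthonormal_on {..<r} v" and M: "M = outer_sum r u s v"
    and s: "\<And>i. i < r \<Longrightarrow> 0 < s i"
    by (auto simp: compact_svd_def)
  have norm_M: "(norm M)\<^sup>2 = (\<Sum>i<r. (s i)\<^sup>2)"
    using inner_outer_sum[OF u v, of s s, folded M]
    by (simp add: power2_norm_eq_inner flip: power2_eq_square)
  have "s i \<le> norm M" if "i < r" for i
  proof (rule power2_le_imp_le)
    show "(s i)\<^sup>2 \<le> (norm M)\<^sup>2"
      unfolding norm_M using that by (intro member_le_sum) auto
  qed simp
  then have scaled: "0 < s i / norm M" "s i / norm M \<le> 1" if "i < r" for i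
    using s that by (force simp: divide_simps intro: less_le_trans)+
  have "(1 / norm M) *\<^sub>R M = outer_sum r u (\<lambda>i. s i / norm M) v"
    unfolding arg_cong[OF M, of "scaleR (1 / norm M)"] by (simp add: outer_sum_def scaleR_sum_right)
  then have "(newton_schulz_step ^^ n) ((1 / norm M) *\<^sub>R M)
      = outer_sum r u (\<lambda>i. (newton_schulz_scalar ^^ n) (s i / norm M)) v" for n
    by (simp only: funpow_newton_schulz_step_outer_sum[OF u v])
  then show ?thesis
    unfolding polar by (simp only: outer_sum_def)
      (intro tendsto_intros funpow_newton_schulz_scalar_tendsto_1 scaled, auto)
qed

lemma borel_measurable_polar [measurable]: "polar \<in> borel_measurable borel"
proof (rule borel_measurable_LIMSEQ_metric)
  show "(\<lambda>M. (newton_schulz_step ^^ n) ((1 / norm M) *\<^sub>R M)) \<in> borel_measurable borel" for n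
  proof (induction n)
    case (Suc n)
    have "continuous_on UNIV (newton_schulz_step :: real^'n^'m \<Rightarrow> real^'n^'m)"
      unfolding newton_schulz_step_def matrix_matrix_mult_def transpose_def
      by (intro continuous_intros continuous_on_vec_lambda) (auto intro!: continuous_intros)
    then show ?case
      using measurable_compose[OF Suc borel_measurable_continuous_onI] by simp
  qed simp
qed (rule newton_schulz_tendsto_polar)

section \<open>Power inequalities\<close>

lemma powr_le_tangent:
  fixes t s p :: real
  assumes "0 \<le> t" "0 < s" "0 < p" "p \<le> 1"
  shows "t powr p \<le> s powr p + p * s powr (p - 1) * (t - s)"
proof -
  have tangent: "s powr p + p * s powr (p - 1) * (t - s) = s powr p * (p * (t / s) + (1 - p))"
    using assms by (simp add: powr_diff field_simps)
  show ?thesis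
  proof (cases "t = 0")
    case True
    then show ?thesis
      using assms unfolding tangent by simp
  next
    case False
    then have "(t / s) powr p * 1 powr (1 - p) \<le> p * (t / s) + (1 - p) * 1"
      using assms by (intro Youngs_inequality_0) auto
    then have "s powr p * (t / s) powr p \<le> s powr p * (p * (t / s) + (1 - p))"
      by (intro mult_left_mono) auto
    then show ?thesis
      unfolding tangent using assms by (simp add: powr_divide)
  qed
qed

lemma powr_add_le_add_powr:
  fixes a b p :: real
  assumes "0 \<le> a" "0 \<le> b" "0 < p" "p \<le> 1"
  shows "(a + b) powr p \<le> a powr p + b powr p"
proof (cases "a + b = 0")
  case False
  then have pos: "0 < a + b"
    using assms by linarith
  have "x / (a + b) * (a + b) powr p \<le> x powr p" if "0 \<le> x" "x \<le> a + b" for x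
  proof -
    have "x / (a + b) \<le> (x / (a + b)) powr p"
      using that pos assms powr_mono'[of p 1 "x / (a + b)"] by simp
    then have "x / (a + b) * (a + b) powr p \<le> (x / (a + b)) powr p * (a + b) powr p"
      by (intro mult_right_mono) auto
    then show ?thesis
      using that pos by (simp add: powr_divide)
  qed
  then have "a / (a + b) * (a + b) powr p + b / (a + b) * (a + b) powr p \<le> a powr p + b powr p"
    using assms by (intro add_mono) auto
  then show ?thesis
    using pos by (simp add: distrib_right[symmetric] add_divide_distrib[symmetric])
qed simp

lemma powr_max_le:
  fixes a b p :: real
  shows "max a b powr p \<le> a powr p + b powr p"
  by (auto simp: max_def)

lemma add_powr_le:
  fixes a b p :: real
  assumes "0 \<le> a" "0 \<le> b" "0 \<le> p"
  shows "(a + b) powr p \<le> 2 powr p * (a powr p + b powr p)"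
proof -
  have "(a + b) powr p \<le> (2 * max a b) powr p"
    using assms by (intro powr_mono2) auto
  also have "\<dots> \<le> 2 powr p * (a powr p + b powr p)"
    using assms powr_max_le by (simp add: powr_mult mult_left_mono)
  finally show ?thesis .
qed

lemma powr_minus_one_mult_le:
  fixes a b p :: real
  assumes "0 \<le> a" "0 \<le> b" "1 \<le> p"
  shows "a powr (p - 1) * b \<le> a powr p + b powr p"
proof -
  have "a powr (p - 1) * b \<le> max a b powr (p - 1) * max a b"
    using assms by (intro mult_mono powr_mono2) auto
  also have "\<dots> = max a b powr p"
    using assms by (cases "max a b = 0") (auto simp: powr_diff)
  finally show ?thesis
    using powr_max_le[of a b p] by linarith
qed

lemma two_powr_add_le_three_powr:
  fixes p :: real
  assumes "1 \<le> p"
  shows "2 powr p + p \<le> 3 powr p"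
proof -
  have "(1 + p/2) powr (1/p) \<le> 3/2"
    using powr_le_tangent[of "1 + p/2" 1 "1/p"] assms by simp
  then have "((1 + p/2) powr (1/p)) powr p \<le> (3/2) powr p"
    using assms by (intro powr_mono2) auto
  then have bernoulli: "1 + p/2 \<le> (3/2) powr p"
    using assms by (simp add: powr_powr)
  have "2 powr 1 \<le> (2::real) powr p"
    using assms by (intro powr_mono) auto
  then have "2 powr p + p \<le> 2 powr p * (1 + p/2)"
    using assms mult_right_mono[of 2 "2 powr p" "p/2"] by (simp add: algebra_simps)
  also have "\<dots> \<le> 2 powr p * (3/2) powr p"
    using bernoulli by (intro mult_left_mono) auto
  also have "\<dots> = 3 powr p"
    by (simp flip: powr_mult)
  finally show ?thesis .
qed

lemma norm_add_powr_le_if_norm_le: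
  fixes x y :: "'a::real_inner"
  assumes "0 < p" "p \<le> 2" "norm y \<le> norm x"
  shows "norm (x + y) powr p
    \<le> norm x powr p + p * norm x powr (p - 2) * (x \<bullet> y) + norm y powr p"
proof (cases "y = 0")
  case False
  then have pos: "0 < norm y" "0 < norm x"
    using assms(3) by (auto intro: order.strict_trans2)
  have square: "z powr q = (z\<^sup>2) powr (q/2)" if "0 \<le> z" for z q :: real
    using that by (simp add: powr_powr flip: powr_numeral)
  have "norm (x + y) powr p
      \<le> ((norm x)\<^sup>2) powr (p/2) + p/2 * ((norm x)\<^sup>2) powr (p/2 - 1) * ((norm (x + y))\<^sup>2 - (norm x)\<^sup>2)"
    unfolding square[OF norm_ge_zero[of "x + y"]] using pos assms by (intro powr_le_tangent) auto
  also have "\<dots> = norm x powr p + p/2 * norm x powr (p - 2) * (2 * (x \<bullet> y) + (norm y)\<^sup>2)"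
  proof -
    have "(norm (x + y))\<^sup>2 - (norm x)\<^sup>2 = 2 * (x \<bullet> y) + (norm y)\<^sup>2"
      by (simp add: power2_norm_eq_inner inner_add_left inner_add_right inner_commute)
    then show ?thesis
      by (simp add: square[of "norm x"] diff_divide_distrib)
  qed
  also have "\<dots> = norm x powr p + p * norm x powr (p - 2) * (x \<bullet> y)
      + p/2 * (norm x powr (p - 2) * (norm y)\<^sup>2)"
    by (simp add: algebra_simps)
  also have "p/2 * (norm x powr (p - 2) * (norm y)\<^sup>2) \<le> 1 * (norm y powr (p - 2) * (norm y)\<^sup>2)"
    using pos assms by (intro mult_mono mult_right_mono powr_mono2') auto
  also have "1 * (norm y powr (p - 2) * (norm y)\<^sup>2) = norm y powr p"
    using pos by (simp add: powr_diff)
  finally show ?thesis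
    by simp
qed simp

lemma norm_add_powr_le_if_norm_less:
  fixes x y :: "'a::real_inner"
  assumes "1 \<le> p" "norm x < norm y"
  shows "norm (x + y) powr p
    \<le> norm x powr p + p * norm x powr (p - 2) * (x \<bullet> y) + 3 powr p * norm y powr p"
proof -
  have pos: "0 < norm y"
    using assms(2) norm_ge_zero[of x] by linarith
  have "norm x powr (p - 2) * (norm x * norm y) \<le> norm y powr p"
  proof (cases "x = 0")
    case False
    then have "norm x powr (p - 2) * (norm x * norm y) = norm x powr (p - 1) * norm y"
      by (simp add: powr_diff power2_eq_square)
    also have "\<dots> \<le> norm y powr (p - 1) * norm y"
      using assms by (intro mult_right_mono powr_mono2) auto
    also have "\<dots> = norm y powr p"
      using pos by (simp add: powr_diff)
    finally show ?thesis .
  qed simp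
  moreover have "norm x powr (p - 2) * - (x \<bullet> y) \<le> norm x powr (p - 2) * (norm x * norm y)"
    using Cauchy_Schwarz_ineq2[of x y] by (intro mult_left_mono) auto
  ultimately have "p * (norm x powr (p - 2) * - (x \<bullet> y)) \<le> p * norm y powr p"
    using assms by (intro mult_left_mono) auto
  then have cross: "0 \<le> p * norm x powr (p - 2) * (x \<bullet> y) + p * norm y powr p"
    by (simp add: mult.assoc)
  have "norm (x + y) \<le> 2 * norm y"
    using norm_triangle_ineq[of x y] assms(2) by linarith
  then have "norm (x + y) powr p \<le> (2 * norm y) powr p"
    using assms by (intro powr_mono2) auto
  also have "\<dots> = 2 powr p * norm y powr p"
    by (simp add: powr_mult)
  also have "\<dots> \<le> (3 powr p - p) * norm y powr p"
    using two_powr_add_le_three_powr[of p] assms by (intro mult_right_mono) auto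
  finally show ?thesis
    using cross powr_ge_zero[of "norm x" p] unfolding left_diff_distrib by linarith
qed

lemma norm_add_powr_le:
  fixes x y :: "'a::real_inner"
  assumes "1 \<le> p" "p \<le> 2"
  shows "norm (x + y) powr p
    \<le> norm x powr p + p * norm x powr (p - 2) * (x \<bullet> y) + 3 powr p * norm y powr p"
proof (cases "norm y \<le> norm x")
  case True
  then have "norm (x + y) powr p
      \<le> norm x powr p + p * norm x powr (p - 2) * (x \<bullet> y) + 1 * norm y powr p"
    using norm_add_powr_le_if_norm_le[of p y x] assms by simp
  also have "1 * norm y powr p \<le> 3 powr p * norm y powr p"
    using assms by (intro mult_right_mono ge_one_powr_ge_zero) auto
  finally show ?thesis
    by simp
qed (use norm_add_powr_le_if_norm_less[of p x y] assms in simp)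

section \<open>Integrability and conditional expectations\<close>

lemma integrable_mult_AE_bounded:
  fixes f g :: "'a \<Rightarrow> real"
  assumes "integrable M g" "f \<in> borel_measurable M" "AE x in M. \<bar>f x\<bar> \<le> c"
  shows "integrable M (\<lambda>x. f x * g x)"
proof (rule Bochner_Integration.integrable_bound[OF integrable_mult_right[OF assms(1), of c]])
  show "(\<lambda>x. f x * g x) \<in> borel_measurable M"
    using assms by measurable
  show "AE x in M. norm (f x * g x) \<le> norm (c * g x)"
    using assms(3) by eventually_elim (auto simp: abs_mult intro!: mult_right_mono)
qed

lemma integrable_norm_add_powr:
  fixes S T :: "'a \<Rightarrow> 'b::{real_normed_vector, second_countable_topology}"
  assumes [measurable]: "S \<in> borel_measurable M" "T \<in> borel_measurable M"
    and int: "integrable M (\<lambda>x. norm (S x) powr p)" "integrable M (\<lambda>x. norm (T x) powr p)"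
    and p: "0 \<le> p"
  shows "integrable M (\<lambda>x. norm (S x + T x) powr p)"
proof (rule Bochner_Integration.integrable_bound)
  show "integrable M (\<lambda>x. 2 powr p * (norm (S x) powr p + norm (T x) powr p))"
    using int by simp
  have "norm (S x + T x) powr p \<le> 2 powr p * (norm (S x) powr p + norm (T x) powr p)" for x
    using add_powr_le[of "norm (S x)" "norm (T x)" p] p
      powr_mono2[OF _ _ norm_triangle_ineq, of p "S x" "T x"] by fastforce
  then show "AE x in M. norm (norm (S x + T x) powr p)
      \<le> norm (2 powr p * (norm (S x) powr p + norm (T x) powr p))"
    by simp
qed measurable

lemma integrable_norm_powr_minus_one_mult:
  fixes S :: "'a \<Rightarrow> 'b::{real_normed_vector, second_countable_topology}"
    and T :: "'a \<Rightarrow> 'c::{real_normed_vector, second_countable_topology}"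
  assumes [measurable]: "S \<in> borel_measurable M" "T \<in> borel_measurable M"
    and int: "integrable M (\<lambda>x. norm (S x) powr p)" "integrable M (\<lambda>x. norm (T x) powr p)"
    and p: "1 \<le> p"
  shows "integrable M (\<lambda>x. norm (S x) powr (p - 1) * norm (T x))"
proof (rule Bochner_Integration.integrable_bound)
  show "integrable M (\<lambda>x. norm (S x) powr p + norm (T x) powr p)"
    using int by simp
  show "AE x in M. norm (norm (S x) powr (p - 1) * norm (T x))
      \<le> norm (norm (S x) powr p + norm (T x) powr p)"
    using p by (simp add: powr_minus_one_mult_le)
qed measurable

lemma (in finite_measure) integrable_powr_le_one:
  fixes g :: "'a \<Rightarrow> real"
  assumes "integrable M g" "\<And>x. 0 \<le> g x" "0 \<le> p" "p \<le> 1"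
  shows "integrable M (\<lambda>x. g x powr p)"
proof (rule Bochner_Integration.integrable_bound)
  show "integrable M (\<lambda>x. 1 + g x)"
    using assms(1) by simp
  show "(\<lambda>x. g x powr p) \<in> borel_measurable M"
    using assms(1) by measurable
  have "g x powr p \<le> 1 + g x" for x
  proof (cases "g x \<le> 1")
    case True
    then show ?thesis
      using assms(2)[of x] assms(3) powr_le1[of p "g x"] by linarith
  next
    case False
    then show ?thesis
      using assms(4) powr_mono[of p 1 "g x"] by simp
  qed
  then show "AE x in M. norm (g x powr p) \<le> norm (1 + g x)"
    using assms(2) by simp
qed

lemma (in finite_measure) integrable_if_norm_powr_integrable:
  fixes f :: "'a \<Rightarrow> 'b::{banach, second_countable_topology}"
  assumes "f \<in> borel_measurable M" "integrable M (\<lambda>x. norm (f x) powr p)" "1 \<le> p"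
  shows "integrable M f"
proof -
  have "integrable M (\<lambda>x. (norm (f x) powr p) powr (1/p))"
    using assms(3) by (intro integrable_powr_le_one[OF assms(2)]) auto
  then show ?thesis
    using assms(1,3) by (simp add: powr_powr integrable_norm_iff)
qed

lemma real_cond_exp_le_of_nn_cond_exp_le:
  assumes "AE x in M. nn_cond_exp M F (\<lambda>x. ennreal (f x)) x \<le> ennreal (g x)" "\<And>x. 0 \<le> g x"
  shows "AE x in M. real_cond_exp M F f x \<le> g x"
  using assms(1)
proof eventually_elim
  case (elim x)
  then have "enn2real (nn_cond_exp M F (\<lambda>x. ennreal (f x)) x) \<le> g x"
    by (intro enn2real_leI assms(2))
  then show ?case
    unfolding real_cond_exp_def using enn2real_nonneg diff_le_eq add_increasing2
    by (metis (no_types, lifting))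
qed

context finite_measure_subalgebra
begin

lemma real_cond_exp_powr_le_of_pos:
  assumes Z: "integrable M Z" "\<And>x. 0 < Z x" and p: "0 < p" "p \<le> 1"
  shows "AE x in M. real_cond_exp M F (\<lambda>x. Z x powr p) x \<le> real_cond_exp M F Z x powr p"
proof -
  have int: "integrable M (\<lambda>x. Z x powr p)"
    using Z p by (intro integrable_powr_le_one) (auto intro: less_imp_le)
  have inverse: "(\<lambda>x. (Z x powr p) powr (1/p)) = Z"
    using Z(2) p by (auto simp: powr_powr less_imp_le)
  have convex: "convex_on {0<..} (\<lambda>y. y powr (1/p))"
    using p by (intro powr_convex) simp
  have "AE x in M. Z x powr p \<in> {0<..}"
    using Z(2) by (simp add: less_imp_neq[symmetric])
  note jensen = real_cond_exp_jensens_inequality[where a = 0, OF int this _ _ convex]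
  have "AE x in M. real_cond_exp M F (\<lambda>x. Z x powr p) x \<in> {0<..}"
    "AE x in M. real_cond_exp M F (\<lambda>x. Z x powr p) x powr (1/p) \<le> real_cond_exp M F Z x"
    using jensen Z(1) unfolding inverse by auto
  then show ?thesis
  proof eventually_elim
    case (elim x)
    then have "(real_cond_exp M F (\<lambda>x. Z x powr p) x powr (1/p)) powr p \<le> real_cond_exp M F Z x powr p"
      using p by (intro powr_mono2) auto
    then show ?case
      using elim p by (simp add: powr_powr)
  qed
qed

lemma real_cond_exp_powr_le:
  assumes Z: "integrable M Z" "\<And>x. 0 \<le> Z x" and p: "0 < p" "p \<le> 1"
  shows "AE x in M. real_cond_exp M F (\<lambda>x. Z x powr p) x \<le> real_cond_exp M F Z x powr p"
proof -
  have "AE x in M. \<forall>n. real_cond_exp M F (\<lambda>x. Z x powr p) x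
      \<le> (real_cond_exp M F Z x + 1 / Suc n) powr p"
    unfolding AE_all_countable
  proof
    fix n
    define e :: real where "e = 1 / Suc n"
    have e: "0 < e"
      by (simp add: e_def)
    have "AE x in M. real_cond_exp M F (\<lambda>x. Z x powr p) x
        \<le> real_cond_exp M F (\<lambda>x. (Z x + e) powr p) x"
      using Z p e by (intro real_cond_exp_mono integrable_powr_le_one)
        (auto intro!: powr_mono2 add_nonneg_nonneg)
    moreover have "AE x in M. real_cond_exp M F (\<lambda>x. (Z x + e) powr p) x
        \<le> real_cond_exp M F (\<lambda>x. Z x + e) x powr p"
      using Z p e by (intro real_cond_exp_powr_le_of_pos) (auto intro: add_nonneg_pos)
    moreover have "AE x in M. real_cond_exp M F (\<lambda>x. Z x + e) x
        = real_cond_exp M F Z x + real_cond_exp M F (\<lambda>_. e) x"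
      using Z(1) by (intro real_cond_exp_add) auto
    moreover have "AE x in M. real_cond_exp M F (\<lambda>_. e) x = e"
      by (intro real_cond_exp_F_meas) auto
    ultimately show "AE x in M. real_cond_exp M F (\<lambda>x. Z x powr p) x
        \<le> (real_cond_exp M F Z x + 1 / Suc n) powr p"
      by eventually_elim (simp add: e_def)
  qed
  moreover have "AE x in M. 0 \<le> real_cond_exp M F Z x"
    using Z by (intro real_cond_exp_pos) auto
  ultimately show ?thesis
  proof eventually_elim
    case (elim x)
    have "(\<lambda>n. (real_cond_exp M F Z x + 1 / Suc n) powr p)
        \<longlonglongrightarrow> (real_cond_exp M F Z x + 0) powr p"
      using elim(2) p LIMSEQ_Suc[OF lim_1_over_n]
      by (intro tendsto_powr' tendsto_add tendsto_const) auto
    then show ?case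
      using elim(1) by (intro LIMSEQ_le_const) auto
  qed
qed

lemma real_cond_exp_powr_le_add_powr:
  assumes Z: "integrable M Z" "\<And>x. 0 \<le> Z x" and UV: "\<And>x. 0 \<le> U x" "\<And>x. 0 \<le> V x"
    and le: "AE x in M. real_cond_exp M F Z x \<le> U x + V x" and p: "0 < p" "p \<le> 1"
  shows "AE x in M. real_cond_exp M F (\<lambda>x. Z x powr p) x \<le> U x powr p + V x powr p"
proof -
  have "AE x in M. 0 \<le> real_cond_exp M F Z x"
    using Z by (intro real_cond_exp_pos) auto
  with le real_cond_exp_powr_le[OF Z p] show ?thesis
  proof eventually_elim
    case (elim x)
    have "real_cond_exp M F (\<lambda>x. Z x powr p) x \<le> (U x + V x) powr p"
      using elim p by (intro order_trans[OF elim(2)] powr_mono2) auto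
    also have "\<dots> \<le> U x powr p + V x powr p"
      using UV p by (intro powr_add_le_add_powr) auto
    finally show ?case .
  qed
qed

lemma integral_powr_le_add_powr:
  assumes Z: "integrable M Z" "\<And>x. 0 \<le> Z x" and UV: "\<And>x. 0 \<le> U x" "\<And>x. 0 \<le> V x"
    and le: "AE x in M. real_cond_exp M F Z x \<le> U x + V x" and p: "0 < p" "p \<le> 1"
    and int: "integrable M (\<lambda>x. U x powr p)" "integrable M (\<lambda>x. V x powr p)"
  shows "(\<integral>x. Z x powr p \<partial>M) \<le> (\<integral>x. U x powr p \<partial>M) + (\<integral>x. V x powr p \<partial>M)"
proof -
  have int_Z: "integrable M (\<lambda>x. Z x powr p)"
    using Z p by (intro integrable_powr_le_one) auto
  have "(\<integral>x. Z x powr p \<partial>M) = (\<integral>x. real_cond_exp M F (\<lambda>x. Z x powr p) x \<partial>M)"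
    using real_cond_exp_int(2)[OF int_Z] by simp
  also have "\<dots> \<le> (\<integral>x. U x powr p + V x powr p \<partial>M)"
    using int real_cond_exp_int(1)[OF int_Z] real_cond_exp_powr_le_add_powr[OF Z UV le p]
    by (intro integral_mono_AE) auto
  also have "\<dots> = (\<integral>x. U x powr p \<partial>M) + (\<integral>x. V x powr p \<partial>M)"
    using int by simp
  finally show ?thesis .
qed

end

lemma emeasure_distr_density_eq_integral:
  fixes e :: "'a \<Rightarrow> real"
  assumes X: "X \<in> measurable M N" and A: "A \<in> sets N" and e: "integrable M e" "AE x in M. 0 \<le> e x"
  shows "emeasure (distr (density M (\<lambda>x. ennreal (e x))) N X) A
    = ennreal (\<integral>x. e x * indicator A (X x) \<partial>M)"
proof -
  note [measurable] = X borel_measurable_integrable[OF e(1)]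
  have [measurable]: "(\<lambda>x. indicator A (X x) :: real) \<in> borel_measurable M"
    using A by measurable
  have "emeasure (distr (density M (\<lambda>x. ennreal (e x))) N X) A
      = (\<integral>\<^sup>+x. ennreal (e x) * indicator (X -` A \<inter> space M) x \<partial>M)"
    using A by (simp add: emeasure_distr emeasure_density measurable_sets[OF X])
  also have "\<dots> = (\<integral>\<^sup>+x. ennreal (e x * indicator A (X x)) \<partial>M)"
    by (intro nn_integral_cong) (auto simp: indicator_def)
  also have "\<dots> = ennreal (\<integral>x. e x * indicator A (X x) \<partial>M)"
  proof (rule nn_integral_eq_integral)
    show "integrable M (\<lambda>x. e x * indicator A (X x))"
      using integrable_mult_AE_bounded[OF e(1), of "\<lambda>x. indicator A (X x)" 1]
      by (simp add: mult.commute)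
    show "AE x in M. 0 \<le> e x * indicator A (X x)"
      using e(2) by eventually_elim simp
  qed
  finally show ?thesis .
qed

lemma integral_mult_comp_cong:
  fixes f g :: "'a \<Rightarrow> real" and h :: "'b \<Rightarrow> real"
  assumes X: "X \<in> measurable M N" and h: "h \<in> borel_measurable N"
    and f: "integrable M f" "AE x in M. 0 \<le> f x" and g: "integrable M g" "AE x in M. 0 \<le> g x"
    and events: "\<And>A. A \<in> sets N \<Longrightarrow>
      (\<integral>x. f x * indicator A (X x) \<partial>M) = (\<integral>x. g x * indicator A (X x) \<partial>M)"
  shows "(\<integral>x. f x * h (X x) \<partial>M) = (\<integral>x. g x * h (X x) \<partial>M)"
proof -
  note [measurable] = X h borel_measurable_integrable[OF f(1)] borel_measurable_integrable[OF g(1)]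
  have "distr (density M (\<lambda>x. ennreal (f x))) N X = distr (density M (\<lambda>x. ennreal (g x))) N X"
    by (rule measure_eqI) (simp_all add: emeasure_distr_density_eq_integral X f g events)
  then have "integral\<^sup>L (distr (density M (\<lambda>x. ennreal (f x))) N X) h
      = integral\<^sup>L (distr (density M (\<lambda>x. ennreal (g x))) N X) h"
    by (rule arg_cong)
  then show ?thesis
    using f(2) g(2) by (simp add: integral_distr integral_density)
qed

context finite_measure_subalgebra
begin

lemma real_cond_exp_unit_interval:
  assumes "d \<in> borel_measurable M" "\<And>x. 0 \<le> d x" "\<And>x. d x \<le> 1"
  shows "AE x in M. 0 \<le> real_cond_exp M F d x" and "AE x in M. \<bar>real_cond_exp M F d x\<bar> \<le> 1"
proof -
  have int: "integrable M d"
    using assms by (intro integrable_const_bound[of _ 1]) auto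
  show "AE x in M. 0 \<le> real_cond_exp M F d x"
    using assms int by (intro real_cond_exp_ge_c) auto
  moreover have "AE x in M. real_cond_exp M F d x \<le> 1"
    using assms int by (intro real_cond_exp_le_c) auto
  ultimately show "AE x in M. \<bar>real_cond_exp M F d x\<bar> \<le> 1"
    by eventually_elim simp
qed

context
  fixes X :: "'a \<Rightarrow> 'b" and N :: "'b measure" and d :: "'a \<Rightarrow> real" and h :: "'b \<Rightarrow> real"
  assumes X [measurable]: "X \<in> measurable M N" and h [measurable]: "h \<in> borel_measurable N"
    and d [measurable]: "d \<in> borel_measurable M" and d_bounds: "\<And>x. 0 \<le> d x" "\<And>x. d x \<le> 1"
    and indep: "\<And>A. A \<in> sets N \<Longrightarrow>
      AE x in M. real_cond_exp M F (\<lambda>x. d x * indicator A (X x)) x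
        = real_cond_exp M F d x * real_cond_exp M F (\<lambda>x. indicator A (X x)) x"
begin

lemma integral_indicator_mult_cond_indep:
  assumes E [measurable]: "E \<in> sets F"
  shows "(\<integral>x. indicator E x * d x * h (X x) \<partial>M)
    = (\<integral>x. indicator E x * real_cond_exp M F d x * h (X x) \<partial>M)"
proof (rule integral_mult_comp_cong[OF X h])
  define q where "q = real_cond_exp M F d"
  have [measurable]: "q \<in> borel_measurable F" "q \<in> borel_measurable M"
    by (simp_all add: q_def)
  have [measurable]: "E \<in> sets M"
    using E subalg by (auto simp: subalgebra_def)
  have bounds: "AE x in M. \<bar>indicator E x * d x\<bar> \<le> 1" "AE x in M. \<bar>indicator E x * q x\<bar> \<le> 1"
    using d_bounds real_cond_exp_unit_interval(2)[OF d d_bounds] unfolding q_def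
    by (auto simp: indicator_def elim!: eventually_mono)
  then show "integrable M (\<lambda>x. indicator E x * d x)"
    "integrable M (\<lambda>x. indicator E x * real_cond_exp M F d x)"
    unfolding q_def[symmetric] by (auto intro!: integrable_const_bound[of _ 1])
  show "AE x in M. 0 \<le> indicator E x * d x" "AE x in M. 0 \<le> indicator E x * real_cond_exp M F d x"
    using d_bounds real_cond_exp_unit_interval(1)[OF d d_bounds] by (auto elim!: eventually_mono)
  fix A assume [measurable]: "A \<in> sets N"
  have int: "integrable M (\<lambda>x. indicator A (X x) :: real)"
    by (intro integrable_const_bound[of _ 1]) auto
  have "(\<integral>x. indicator E x * d x * indicator A (X x) \<partial>M)
      = (\<integral>x. indicator E x * real_cond_exp M F (\<lambda>x. d x * indicator A (X x)) x \<partial>M)"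
    using integrable_mult_AE_bounded[OF int _ bounds(1)]
    by (subst real_cond_exp_intg(2)) (simp_all add: mult.assoc)
  also have "\<dots> = (\<integral>x. (indicator E x * q x) * real_cond_exp M F (\<lambda>x. indicator A (X x)) x \<partial>M)"
    using indep[of A] unfolding q_def
    by (intro integral_cong_AE) (auto elim!: eventually_mono)
  also have "\<dots> = (\<integral>x. indicator E x * q x * indicator A (X x) \<partial>M)"
    using integrable_mult_AE_bounded[OF int _ bounds(2)] by (intro real_cond_exp_intg(2)) simp_all
  finally show "(\<integral>x. indicator E x * d x * indicator A (X x) \<partial>M)
      = (\<integral>x. indicator E x * real_cond_exp M F d x * indicator A (X x) \<partial>M)"
    unfolding q_def .
qed

lemma real_cond_exp_mult_cond_indep:
  assumes int: "integrable M (\<lambda>x. h (X x))"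
  shows "AE x in M. real_cond_exp M F (\<lambda>x. d x * h (X x)) x
    = real_cond_exp M F d x * real_cond_exp M F (\<lambda>x. h (X x)) x"
proof (rule real_cond_exp_charact)
  define q where "q = real_cond_exp M F d"
  have [measurable]: "q \<in> borel_measurable F" "q \<in> borel_measurable M"
    by (simp_all add: q_def)
  show "integrable M (\<lambda>x. d x * h (X x))"
    using d_bounds by (intro integrable_mult_AE_bounded[OF int, of _ 1]) auto
  have int_q: "integrable M (\<lambda>x. q x * h (X x))"
    using real_cond_exp_unit_interval(2)[OF d d_bounds] unfolding q_def[symmetric]
    by (intro integrable_mult_AE_bounded[OF int, of _ 1]) auto
  then show "integrable M (\<lambda>x. real_cond_exp M F d x * real_cond_exp M F (\<lambda>x. h (X x)) x)"
    unfolding q_def[symmetric] by (intro real_cond_exp_intg(1)) simp_all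
  fix E assume E [measurable]: "E \<in> sets F"
  have [measurable]: "E \<in> sets M"
    using E subalg by (auto simp: subalgebra_def)
  have "(\<integral>x\<in>E. d x * h (X x) \<partial>M) = (\<integral>x. (indicator E x * q x) * h (X x) \<partial>M)"
    using integral_indicator_mult_cond_indep[OF E]
    by (simp add: set_lebesgue_integral_def mult.assoc q_def)
  also have "\<dots> = (\<integral>x. (indicator E x * q x) * real_cond_exp M F (\<lambda>x. h (X x)) x \<partial>M)"
    using integrable_mult_AE_bounded[OF int_q, of "indicator E" 1]
    by (intro real_cond_exp_intg(2)[symmetric]) (auto simp: mult.assoc indicator_le_1)
  finally show "(\<integral>x\<in>E. d x * h (X x) \<partial>M)
      = (\<integral>x\<in>E. real_cond_exp M F d x * real_cond_exp M F (\<lambda>x. h (X x)) x \<partial>M)"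
    by (simp add: set_lebesgue_integral_def mult.assoc q_def)
qed measurable

end

end

lemma set_integral_eq_0_sigma_sets:
  fixes f :: "'a \<Rightarrow> 'b::{banach, second_countable_topology}"
  assumes f: "integrable M f" and E: "Int_stable E" "E \<subseteq> sets M" "space M \<in> E"
    and zero: "\<And>A. A \<in> E \<Longrightarrow> (\<integral>x\<in>A. f x \<partial>M) = 0"
    and A: "A \<in> sigma_sets (space M) E"
  shows "(\<integral>x\<in>A. f x \<partial>M) = 0"
proof -
  have sets: "A \<in> sets M" if "A \<in> sigma_sets (space M) E" for A
    using sets.sigma_sets_subset[OF E(2)] that by blast
  have int: "set_integrable M A f" if "A \<in> sets M" for A
    using that f unfolding set_integrable_def by (rule integrable_mult_indicator)
  have "E \<subseteq> Pow (space M)"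
    using E(2) sets.space_closed by blast
  with E(1) show ?thesis
    using A
  proof (induction rule: sigma_sets_induct_disjoint)
    case (compl A)
    have "(\<integral>x\<in>A \<union> (space M - A). f x \<partial>M) = 0"
      using zero[OF E(3)] sets.sets_into_space[OF sets[OF compl(1)]] by (simp add: Un_absorb1)
    then show ?case
      using compl sets[OF compl(1)] by (subst (asm) set_integral_Un) (auto intro: int)
  next
    case (union A)
    then have "A i \<in> sets M" for i
      using sets by blast
    with union show ?case
      by (subst lebesgue_integral_countable_add) (auto simp: disjoint_family_on_def intro: int)
  next
    case (basic A)
    then show ?case
      by (rule zero)
  qed (simp add: set_lebesgue_integral_def)
qed

lemma (in sigma_finite_subalgebra) real_cond_exp_le_linear_combination:
  assumes int: "integrable M f" "integrable M a" "integrable M b" "integrable M g"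
    and le: "\<And>x. f x \<le> a x + b x + c * g x"
  shows "AE x in M. real_cond_exp M F f x
    \<le> real_cond_exp M F a x + real_cond_exp M F b x + c * real_cond_exp M F g x"
proof -
  have "AE x in M. real_cond_exp M F f x \<le> real_cond_exp M F (\<lambda>x. a x + b x + c * g x) x"
    using int le by (intro real_cond_exp_mono) auto
  moreover have "AE x in M. real_cond_exp M F (\<lambda>x. a x + b x + c * g x) x
      = real_cond_exp M F (\<lambda>x. a x + b x) x + real_cond_exp M F (\<lambda>x. c * g x) x"
    using int by (intro real_cond_exp_add) auto
  moreover note real_cond_exp_add[OF int(2,3)] real_cond_exp_cmult[OF int(4), of c]
  ultimately show ?thesis
    by eventually_elim simp
qed

lemma (in sigma_finite_subalgebra) real_cond_exp_inner_eq_0: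
  fixes \<psi> Y :: "'a \<Rightarrow> 'b::euclidean_space"
  assumes \<psi>: "\<psi> \<in> borel_measurable F" and Y: "Y \<in> borel_measurable M"
    and int: "integrable M (\<lambda>x. norm (\<psi> x) * norm (Y x))"
    and centered: "\<And>b. b \<in> Basis \<Longrightarrow> AE x in M. real_cond_exp M F (\<lambda>x. Y x \<bullet> b) x = 0"
  shows "integrable M (\<lambda>x. \<psi> x \<bullet> Y x)" and "AE x in M. real_cond_exp M F (\<lambda>x. \<psi> x \<bullet> Y x) x = 0"
proof -
  note [measurable] = \<psi> Y measurable_from_subalg[OF subalg \<psi>]
  have coordinates: "(\<lambda>x. \<psi> x \<bullet> Y x) = (\<lambda>x. \<Sum>b\<in>Basis. (\<psi> x \<bullet> b) * (Y x \<bullet> b))"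
    by (simp add: euclidean_inner[symmetric])
  have int_b: "integrable M (\<lambda>x. (\<psi> x \<bullet> b) * (Y x \<bullet> b))" for b
  proof (rule Bochner_Integration.integrable_bound)
    show "integrable M (\<lambda>x. (norm b)\<^sup>2 * (norm (\<psi> x) * norm (Y x)))"
      using int by simp
    have "norm ((\<psi> x \<bullet> b) * (Y x \<bullet> b)) \<le> (norm (\<psi> x) * norm b) * (norm (Y x) * norm b)" for x
      unfolding norm_mult by (intro mult_mono) (auto intro: Cauchy_Schwarz_ineq2)
    then show "AE x in M. norm ((\<psi> x \<bullet> b) * (Y x \<bullet> b)) \<le> norm ((norm b)\<^sup>2 * (norm (\<psi> x) * norm (Y x)))"
      by (simp add: power2_eq_square mult_ac)
  qed measurable
  then show "integrable M (\<lambda>x. \<psi> x \<bullet> Y x)"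
    unfolding coordinates by simp
  have "AE x in M. \<forall>b\<in>Basis. real_cond_exp M F (\<lambda>x. (\<psi> x \<bullet> b) * (Y x \<bullet> b)) x = 0"
  proof (rule AE_finite_allI[OF finite_Basis])
    fix b :: 'b assume "b \<in> Basis"
    have "AE x in M. real_cond_exp M F (\<lambda>x. (\<psi> x \<bullet> b) * (Y x \<bullet> b)) x
        = (\<psi> x \<bullet> b) * real_cond_exp M F (\<lambda>x. Y x \<bullet> b) x"
      by (intro real_cond_exp_mult int_b) measurable
    with centered[OF \<open>b \<in> Basis\<close>]
    show "AE x in M. real_cond_exp M F (\<lambda>x. (\<psi> x \<bullet> b) * (Y x \<bullet> b)) x = 0"
      by eventually_elim simp
  qed
  moreover have "AE x in M. real_cond_exp M F (\<lambda>x. \<Sum>b\<in>Basis. (\<psi> x \<bullet> b) * (Y x \<bullet> b)) x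
      = (\<Sum>b\<in>Basis. real_cond_exp M F (\<lambda>x. (\<psi> x \<bullet> b) * (Y x \<bullet> b)) x)"
    by (intro real_cond_exp_sum int_b)
  ultimately show "AE x in M. real_cond_exp M F (\<lambda>x. \<psi> x \<bullet> Y x) x = 0"
    unfolding coordinates by eventually_elim simp
qed

section \<open>Weighted sums of heavy-tailed batch noise\<close>

text \<open>\<open>D k\<close> plays the role of the gradient at the \<open>k\<close>-th iterate.\<close>

locale heavy_tailed_batches = prob_space P for P :: "'w measure" +
  fixes F :: "nat \<Rightarrow> 'w measure"
    and G :: "nat \<Rightarrow> nat \<Rightarrow> 'w \<Rightarrow> 'a::euclidean_space"
    and D :: "nat \<Rightarrow> 'w \<Rightarrow> 'a"
    and B :: nat and \<alpha> \<sigma>0 \<sigma>1 :: real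
  assumes \<alpha>: "1 < \<alpha>" "\<alpha> \<le> 2"
    and \<sigma>: "0 \<le> \<sigma>0" "0 \<le> \<sigma>1"
    and F_sub: "\<And>k. subalgebra P (F k)"
    and F_mono: "\<And>k. sets (F k) \<subseteq> sets (F (Suc k))"
    and D_meas: "\<And>k. D k \<in> borel_measurable (F k)"
    and D_bounded: "\<And>k. \<exists>c. \<forall>w. norm (D k w) \<le> c"
    and G_meas: "\<And>k i. i \<in> {1..B} \<Longrightarrow> G k i \<in> borel_measurable (F (Suc k))"
    and G_indep: "\<And>k (A :: nat \<Rightarrow> 'a set). (\<And>i. A i \<in> sets borel) \<Longrightarrow>
         AE w in P. real_cond_exp P (F k) (\<lambda>w. \<Prod>i\<in>{1..B}. indicator (A i) (G k i w)) w
                   = (\<Prod>i\<in>{1..B}. real_cond_exp P (F k) (\<lambda>w. indicator (A i) (G k i w)) w)"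
    and G_unbiased: "\<And>k i b. i \<in> {1..B} \<Longrightarrow> b \<in> Basis \<Longrightarrow>
         AE w in P. real_cond_exp P (F k) (\<lambda>w. G k i w \<bullet> b) w = D k w \<bullet> b"
    and G_moment: "\<And>k i. i \<in> {1..B} \<Longrightarrow>
         AE w in P. nn_cond_exp P (F k) (\<lambda>w. ennreal (norm (G k i w - D k w) powr \<alpha>)) w
                   \<le> ennreal (\<sigma>0 powr \<alpha> + \<sigma>1 powr \<alpha> * norm (D k w) powr \<alpha>)"
begin

definition noise :: "nat \<Rightarrow> nat \<Rightarrow> 'w \<Rightarrow> 'a" where
  "noise k i w = G k i w - D k w"

definition moment_bound :: "nat \<Rightarrow> 'w \<Rightarrow> real" where
  "moment_bound k w = \<sigma>0 powr \<alpha> + \<sigma>1 powr \<alpha> * norm (D k w) powr \<alpha>"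

lemma finite_measure_subalgebra_F: "finite_measure_subalgebra P (F k)"
  using F_sub by unfold_locales

lemma F_mono_le: "j \<le> k \<Longrightarrow> sets (F j) \<subseteq> sets (F k)"
  using F_mono by (rule lift_Suc_mono_le)

lemma measurable_F_mono:
  assumes "f \<in> measurable (F j) N" "j \<le> k"
  shows "f \<in> measurable (F k) N"
  by (rule measurable_from_subalg[OF _ assms(1)])
    (use F_mono_le[OF assms(2)] F_sub in \<open>auto simp: subalgebra_def\<close>)

lemma D_measurable_P [measurable]: "D k \<in> borel_measurable P"
  using measurable_from_subalg[OF F_sub D_meas] .

lemma G_measurable_P [measurable]: "i \<in> {1..B} \<Longrightarrow> G k i \<in> borel_measurable P"
  using measurable_from_subalg[OF F_sub G_meas] .

lemma noise_measurable_P [measurable]: "i \<in> {1..B} \<Longrightarrow> noise k i \<in> borel_measurable P"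
  unfolding noise_def by measurable

lemma moment_bound_nonneg: "0 \<le> moment_bound k w"
  by (simp add: moment_bound_def)

lemma integrable_D: "integrable P (D k)"
proof -
  obtain c where "norm (D k w) \<le> c" for w
    using D_bounded by blast
  then show ?thesis
    by (intro integrable_const_bound[of _ c]) auto
qed

lemma integrable_moment_bound: "integrable P (moment_bound k)"
proof -
  obtain c where "norm (D k w) \<le> c" for w
    using D_bounded by blast
  then have "norm (D k w) powr \<alpha> \<le> c powr \<alpha>" for w
    using \<alpha> by (intro powr_mono2) auto
  then have "integrable P (\<lambda>w. norm (D k w) powr \<alpha>)"
    by (intro integrable_const_bound[of _ "c powr \<alpha>"]) auto
  then show ?thesis
    unfolding moment_bound_def by simp
qed

lemma cond_exp_noise_powr_le:
  assumes "i \<in> {1..B}"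
  shows "AE w in P. real_cond_exp P (F k) (\<lambda>w. norm (noise k i w) powr \<alpha>) w \<le> moment_bound k w"
  using G_moment[OF assms] moment_bound_nonneg
  unfolding noise_def moment_bound_def by (intro real_cond_exp_le_of_nn_cond_exp_le) auto

lemma integrable_noise_powr:
  assumes i: "i \<in> {1..B}"
  shows "integrable P (\<lambda>w. norm (noise k i w) powr \<alpha>)"
proof (rule integrableI_bounded)
  interpret Fk: finite_measure_subalgebra P "F k"
    by (rule finite_measure_subalgebra_F)
  have [measurable]: "noise k i \<in> borel_measurable P"
    using i by measurable
  show "(\<lambda>w. norm (noise k i w) powr \<alpha>) \<in> borel_measurable P"
    by measurable
  have "(\<integral>\<^sup>+ w. ennreal (norm (noise k i w) powr \<alpha>) \<partial>P)
      = (\<integral>\<^sup>+ w. nn_cond_exp P (F k) (\<lambda>w. ennreal (norm (noise k i w) powr \<alpha>)) w \<partial>P)"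
    using Fk.nn_cond_exp_intg[of "\<lambda>_. 1" "\<lambda>w. ennreal (norm (noise k i w) powr \<alpha>)"] by simp
  also have "\<dots> \<le> (\<integral>\<^sup>+ w. ennreal (moment_bound k w) \<partial>P)"
    using G_moment[OF i] unfolding noise_def moment_bound_def by (rule nn_integral_mono_AE)
  also have "\<dots> < \<infinity>"
    using integrable_moment_bound[of k] moment_bound_nonneg
    by (simp add: integrable_iff_bounded)
  finally show "(\<integral>\<^sup>+ w. ennreal (norm (norm (noise k i w) powr \<alpha>)) \<partial>P) < \<infinity>"
    by simp
qed

lemma integrable_noise: "i \<in> {1..B} \<Longrightarrow> integrable P (noise k i)"
  using \<alpha> integrable_if_norm_powr_integrable[OF noise_measurable_P integrable_noise_powr] by simp

lemma integrable_G:
  assumes "i \<in> {1..B}"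
  shows "integrable P (G k i)"
proof -
  have "G k i = (\<lambda>w. noise k i w + D k w)"
    by (simp add: noise_def fun_eq_iff)
  then show ?thesis
    using integrable_noise[OF assms] integrable_D by simp
qed

subsection \<open>The samples of one batch as martingale differences\<close>

definition past_indicator :: "nat \<Rightarrow> nat \<Rightarrow> (nat \<Rightarrow> 'a set) \<Rightarrow> 'w \<Rightarrow> real" where
  "past_indicator k i A w = (\<Prod>j\<in>{1..<i}. indicator (A j) (G k j w))"

lemma past_indicator_bounds: "0 \<le> past_indicator k i A w" "past_indicator k i A w \<le> 1"
  unfolding past_indicator_def by (auto intro!: prod_nonneg prod_le_1 simp: indicator_def)

lemma past_indicator_measurable:
  assumes "i \<in> {1..B}" "\<And>j. A j \<in> sets borel"
  shows "past_indicator k i A \<in> borel_measurable P"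
  unfolding past_indicator_def
proof (rule borel_measurable_prod)
  fix j assume "j \<in> {1..<i}"
  then have [measurable]: "G k j \<in> borel_measurable P"
    using assms(1) by auto
  note [measurable] = assms(2)[of j]
  show "(\<lambda>w. indicator (A j) (G k j w) :: real) \<in> borel_measurable P"
    by measurable
qed

lemma cond_exp_past_indicator_mult_indicator_eq_prod:
  assumes i: "i \<in> {1..B}" and A: "\<And>j. A j \<in> sets borel" and C: "C \<in> sets borel"
  shows "AE w in P. real_cond_exp P (F k) (\<lambda>w. past_indicator k i A w * indicator C (G k i w)) w
    = (\<Prod>j\<in>{1..<i}. real_cond_exp P (F k) (\<lambda>w. indicator (A j) (G k j w)) w)
        * real_cond_exp P (F k) (\<lambda>w. indicator C (G k i w)) w"
proof -
  interpret Fk: finite_measure_subalgebra P "F k"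
    by (rule finite_measure_subalgebra_F)
  have "{1..B} = {1..<i} \<union> {i} \<union> {i<..B}"
    using i by auto
  then have prod_split: "(\<Prod>j\<in>{1..B}. g j) = (\<Prod>j\<in>{1..<i}. g j) * g i * (\<Prod>j\<in>{i<..B}. g j)"
    for g :: "nat \<Rightarrow> real"
    by (simp only:) (subst prod.union_disjoint; (subst prod.union_disjoint)?; auto)
  define A' where "A' j = (if j < i then A j else if j = i then C else UNIV)" for j
  have "A' j \<in> sets borel" for j
    using A C by (simp add: A'_def)
  note independent = G_indep[of A' k, OF this]
  have "AE w in P. real_cond_exp P (F k) (\<lambda>w. 1) w = 1"
    by (rule Fk.real_cond_exp_F_meas) auto
  with independent show ?thesis
  proof eventually_elim
    case (elim w)
    have "(\<lambda>w. \<Prod>j\<in>{1..B}. indicator (A' j) (G k j w))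
        = (\<lambda>w. past_indicator k i A w * indicator C (G k i w) :: real)"
      unfolding prod_split past_indicator_def by (simp add: A'_def)
    moreover have "(\<Prod>j\<in>{1..B}. real_cond_exp P (F k) (\<lambda>w. indicator (A' j) (G k j w)) w)
        = (\<Prod>j\<in>{1..<i}. real_cond_exp P (F k) (\<lambda>w. indicator (A j) (G k j w)) w)
          * real_cond_exp P (F k) (\<lambda>w. indicator C (G k i w)) w"
      unfolding prod_split using elim by (simp add: A'_def)
    ultimately show ?case
      using elim by simp
  qed
qed

lemma cond_exp_past_indicator_mult_indicator:
  assumes i: "i \<in> {1..B}" and A: "\<And>j. A j \<in> sets borel" and C: "C \<in> sets borel"
  shows "AE w in P. real_cond_exp P (F k) (\<lambda>w. past_indicator k i A w * indicator C (G k i w)) w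
    = real_cond_exp P (F k) (past_indicator k i A) w
        * real_cond_exp P (F k) (\<lambda>w. indicator C (G k i w)) w"
proof -
  interpret Fk: finite_measure_subalgebra P "F k"
    by (rule finite_measure_subalgebra_F)
  have "AE w in P. real_cond_exp P (F k) (\<lambda>w. 1) w = 1"
    by (rule Fk.real_cond_exp_F_meas) auto
  moreover have "AE w in P. real_cond_exp P (F k) (past_indicator k i A) w
      = (\<Prod>j\<in>{1..<i}. real_cond_exp P (F k) (\<lambda>w. indicator (A j) (G k j w)) w)
        * real_cond_exp P (F k) (\<lambda>w. 1) w"
    using cond_exp_past_indicator_mult_indicator_eq_prod[where A = A and C = UNIV and k = k, OF i A]
    by simp
  moreover note cond_exp_past_indicator_mult_indicator_eq_prod[where A = A and k = k, OF i A C]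
  ultimately show ?thesis
    by eventually_elim simp
qed

lemma cond_exp_past_indicator_noise_eq_0:
  assumes i: "i \<in> {1..B}" and A: "\<And>j. A j \<in> sets borel" and b: "b \<in> Basis"
  shows "integrable P (\<lambda>w. past_indicator k i A w * (noise k i w \<bullet> b))"
    and "AE w in P. real_cond_exp P (F k) (\<lambda>w. past_indicator k i A w * (noise k i w \<bullet> b)) w = 0"
proof -
  interpret Fk: finite_measure_subalgebra P "F k"
    by (rule finite_measure_subalgebra_F)
  define d where "d = past_indicator k i A"
  have [measurable]: "G k i \<in> borel_measurable P" "d \<in> borel_measurable P"
    using i past_indicator_measurable[OF i A] by (auto simp: d_def)
  note [measurable] = D_meas[of k]
  have d_bounds: "0 \<le> d w" "d w \<le> 1" for w
    using past_indicator_bounds by (auto simp: d_def)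
  have int_G: "integrable P (\<lambda>w. d w * (G k i w \<bullet> b))"
    using d_bounds integrable_G[OF i] by (intro integrable_mult_AE_bounded[of _ _ _ 1]) auto
  have int_D: "integrable P (\<lambda>w. (D k w \<bullet> b) * d w)"
    unfolding mult.commute[of "D k _ \<bullet> b"]
    using d_bounds integrable_D by (intro integrable_mult_AE_bounded[of _ _ _ 1]) auto
  have split: "(\<lambda>w. d w * (noise k i w \<bullet> b)) = (\<lambda>w. d w * (G k i w \<bullet> b) - (D k w \<bullet> b) * d w)"
    by (simp add: noise_def inner_diff_left algebra_simps)
  show "integrable P (\<lambda>w. past_indicator k i A w * (noise k i w \<bullet> b))"
    unfolding d_def[symmetric] split using int_G int_D by simp
  have "AE w in P. real_cond_exp P (F k) (\<lambda>w. d w * (G k i w \<bullet> b)) w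
      = real_cond_exp P (F k) d w * real_cond_exp P (F k) (\<lambda>w. G k i w \<bullet> b) w"
    using cond_exp_past_indicator_mult_indicator[where A = A and k = k, OF i A]
      d_bounds integrable_G[OF i] unfolding d_def[symmetric]
    by (intro Fk.real_cond_exp_mult_cond_indep[where X = "G k i" and N = borel and h = "\<lambda>x. x \<bullet> b"])
      auto
  moreover have "AE w in P. real_cond_exp P (F k) (\<lambda>w. (D k w \<bullet> b) * d w) w
      = (D k w \<bullet> b) * real_cond_exp P (F k) d w"
    using int_D by (intro Fk.real_cond_exp_mult) auto
  moreover note G_unbiased[OF i b, of k] Fk.real_cond_exp_diff[OF int_G int_D]
  ultimately show "AE w in P. real_cond_exp P (F k)
      (\<lambda>w. past_indicator k i A w * (noise k i w \<bullet> b)) w = 0"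
    unfolding d_def[symmetric] split by eventually_elim simp
qed

definition history_events :: "nat \<Rightarrow> nat \<Rightarrow> 'w set set" where
  "history_events k i =
     {E \<inter> {w \<in> space P. \<forall>j\<in>{1..<i}. G k j w \<in> A j} | E A. E \<in> sets (F k) \<and> (\<forall>j. A j \<in> sets borel)}"

definition history :: "nat \<Rightarrow> nat \<Rightarrow> 'w measure" where
  "history k i = sigma (space P) (history_events k i)"

lemma history_eventsI:
  "E \<in> sets (F k) \<Longrightarrow> (\<And>j. A j \<in> sets borel) \<Longrightarrow>
    E \<inter> {w \<in> space P. \<forall>j\<in>{1..<i}. G k j w \<in> A j} \<in> history_events k i"
  unfolding history_events_def by blast

lemma history_eventsE:
  assumes "C \<in> history_events k i"
  obtains E A where "E \<in> sets (F k)" "\<forall>j. A j \<in> sets borel"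
    "C = E \<inter> {w \<in> space P. \<forall>j\<in>{1..<i}. G k j w \<in> A j}"
  using assms unfolding history_events_def by blast

lemma space_mem_history_events: "space P \<in> history_events k i"
  using history_eventsI[of "space P" k "\<lambda>_. UNIV" i] F_sub[of k] sets.top[of "F k"]
  by (simp add: subalgebra_def)

lemma F_subset_history_events: "sets (F k) \<subseteq> history_events k i"
proof
  fix E assume E: "E \<in> sets (F k)"
  then have "E \<subseteq> space P"
    using F_sub[of k] sets.sets_into_space by (fastforce simp: subalgebra_def)
  then show "E \<in> history_events k i"
    using history_eventsI[OF E, of "\<lambda>_. UNIV" i] by (simp add: Int_absorb2)
qed

lemma history_events_subset_sets:
  assumes "i \<in> {1..B}"
  shows "history_events k i \<subseteq> sets P"
proof
  fix C assume "C \<in> history_events k i"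
  then obtain E A where E: "E \<in> sets (F k)" and A: "\<forall>j. A j \<in> sets borel"
    and C: "C = E \<inter> {w \<in> space P. \<forall>j\<in>{1..<i}. G k j w \<in> A j}"
    by (rule history_eventsE)
  have "{w \<in> space P. \<forall>j\<in>{1..<i}. G k j w \<in> A j} \<in> sets P"
  proof (rule sets.sets_Collect_finite_All)
    fix j assume "j \<in> {1..<i}"
    then have [measurable]: "G k j \<in> borel_measurable P"
      using assms by auto
    have [measurable]: "A j \<in> sets borel"
      using A by simp
    show "{w \<in> space P. G k j w \<in> A j} \<in> sets P"
      by measurable
  qed auto
  moreover have "E \<in> sets P"
    using E F_sub[of k] by (auto simp: subalgebra_def)
  ultimately show "C \<in> sets P"
    by (simp add: C)
qed

lemma Int_stable_history_events: "Int_stable (history_events k i)"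
proof (rule Int_stableI)
  fix C C' assume "C \<in> history_events k i" "C' \<in> history_events k i"
  then obtain E A E' A' where sets: "E \<in> sets (F k)" "E' \<in> sets (F k)"
      "\<forall>j. A j \<in> sets borel" "\<forall>j. A' j \<in> sets borel"
    and "C = E \<inter> {w \<in> space P. \<forall>j\<in>{1..<i}. G k j w \<in> A j}"
      "C' = E' \<inter> {w \<in> space P. \<forall>j\<in>{1..<i}. G k j w \<in> A' j}"
    by (elim history_eventsE) blast
  then have "C \<inter> C' = (E \<inter> E') \<inter> {w \<in> space P. \<forall>j\<in>{1..<i}. G k j w \<in> A j \<inter> A' j}"
    by auto
  also have "\<dots> \<in> history_events k i"
    using sets by (intro history_eventsI) auto
  finally show "C \<inter> C' \<in> history_events k i" .
qed

lemma history_events_into_space: "history_events k i \<subseteq> Pow (space P)"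
  unfolding history_events_def by auto

lemma space_history [simp]: "space (history k i) = space P"
  by (simp add: history_def history_events_into_space space_measure_of)

lemma sets_history: "sets (history k i) = sigma_sets (space P) (history_events k i)"
  by (simp add: history_def history_events_into_space sets_measure_of)

lemma subalgebra_history: "i \<in> {1..B} \<Longrightarrow> subalgebra P (history k i)"
  unfolding subalgebra_def sets_history
  by (simp add: sets.sigma_sets_subset history_events_subset_sets)

lemma subalgebra_history_F: "subalgebra (history k i) (F k)"
  using F_sub[of k] F_subset_history_events[of k i] by (auto simp: subalgebra_def sets_history)

lemma measurable_history_G:
  assumes "j \<in> {1..<i}"
  shows "G k j \<in> borel_measurable (history k i)"
proof (rule measurableI)
  fix C :: "'a set" assume C: "C \<in> sets borel"
  have "G k j -` C \<inter> space (history k i)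
      = space P \<inter> {w \<in> space P. \<forall>l\<in>{1..<i}. G k l w \<in> (if l = j then C else UNIV)}"
    using assms by auto
  also have "\<dots> \<in> history_events k i"
    using C F_sub[of k] sets.top[of "F k"] by (intro history_eventsI) (auto simp: subalgebra_def)
  finally show "G k j -` C \<inter> space (history k i) \<in> sets (history k i)"
    by (simp add: sets_history)
qed simp

lemma set_integral_history_event_noise_eq_0:
  assumes i: "i \<in> {1..B}" and b: "b \<in> Basis" and C: "C \<in> history_events k i"
  shows "(\<integral>w\<in>C. noise k i w \<bullet> b \<partial>P) = 0"
proof -
  interpret Fk: finite_measure_subalgebra P "F k"
    by (rule finite_measure_subalgebra_F)
  obtain E A where E: "E \<in> sets (F k)" and A: "\<forall>j. A j \<in> sets borel"
    and C: "C = E \<inter> {w \<in> space P. \<forall>j\<in>{1..<i}. G k j w \<in> A j}"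
    using C by (rule history_eventsE)
  note past_noise = cond_exp_past_indicator_noise_eq_0[where A = A and k = k, OF i A[rule_format] b]
  have [measurable]: "E \<in> sets P"
    using E F_sub[of k] by (auto simp: subalgebra_def)
  have "past_indicator k i A w = (if \<forall>j\<in>{1..<i}. G k j w \<in> A j then 1 else 0)" for w
    unfolding past_indicator_def by (auto simp: indicator_def intro!: prod.neutral)
  then have "indicator C w * (noise k i w \<bullet> b)
      = indicator E w * (past_indicator k i A w * (noise k i w \<bullet> b))"
    if "w \<in> space P" for w
    using that by (auto simp: C indicator_def)
  then have "(\<integral>w\<in>C. noise k i w \<bullet> b \<partial>P) = (\<integral>w\<in>E. past_indicator k i A w * (noise k i w \<bullet> b) \<partial>P)"
    unfolding set_lebesgue_integral_def by (intro Bochner_Integration.integral_cong) auto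
  also have "\<dots> = (\<integral>w\<in>E. real_cond_exp P (F k) (\<lambda>w. past_indicator k i A w * (noise k i w \<bullet> b)) w \<partial>P)"
    using past_noise(1) E by (rule Fk.real_cond_exp_intA)
  also have "\<dots> = (\<integral>w\<in>E. 0 \<partial>P)"
    using past_noise(2) unfolding set_lebesgue_integral_def by (intro integral_cong_AE) auto
  finally show ?thesis
    by (simp add: set_lebesgue_integral_def)
qed

lemma cond_exp_history_noise_eq_0:
  assumes i: "i \<in> {1..B}" and b: "b \<in> Basis"
  shows "AE w in P. real_cond_exp P (history k i) (\<lambda>w. noise k i w \<bullet> b) w = 0"
proof -
  interpret H: finite_measure_subalgebra P "history k i"
    using subalgebra_history[OF i] by unfold_locales
  have int: "integrable P (\<lambda>w. noise k i w \<bullet> b)"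
    using integrable_noise[OF i] by simp
  have "(\<integral>w\<in>C. noise k i w \<bullet> b \<partial>P) = 0" if "C \<in> sets (history k i)" for C
    using set_integral_history_event_noise_eq_0[OF i b] that unfolding sets_history
    by (rule set_integral_eq_0_sigma_sets[OF int Int_stable_history_events
          history_events_subset_sets[OF i] space_mem_history_events])
  then show ?thesis
    using int by (intro H.real_cond_exp_charact) (auto simp: set_lebesgue_integral_def)
qed

lemma cond_exp_inner_noise_eq_0:
  assumes i: "i \<in> {1..B}" and \<psi>: "\<psi> \<in> borel_measurable (history k i)"
    and int: "integrable P (\<lambda>w. norm (\<psi> w) * norm (noise k i w))"
  shows "integrable P (\<lambda>w. \<psi> w \<bullet> noise k i w)"
    and "AE w in P. real_cond_exp P (F k) (\<lambda>w. \<psi> w \<bullet> noise k i w) w = 0"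
proof -
  interpret H: finite_measure_subalgebra P "history k i"
    using subalgebra_history[OF i] by unfold_locales
  interpret Fk: finite_measure_subalgebra P "F k"
    by (rule finite_measure_subalgebra_F)
  note centered = H.real_cond_exp_inner_eq_0[OF \<psi> noise_measurable_P[OF i] int
      cond_exp_history_noise_eq_0[OF i]]
  show int_inner: "integrable P (\<lambda>w. \<psi> w \<bullet> noise k i w)"
    by (rule centered(1))
  let ?H = "real_cond_exp P (history k i) (\<lambda>w. \<psi> w \<bullet> noise k i w)"
  have "AE w in P. real_cond_exp P (F k) ?H w = real_cond_exp P (F k) (\<lambda>w. \<psi> w \<bullet> noise k i w) w"
    by (intro Fk.real_cond_exp_nested_subalg subalgebra_history[OF i] subalgebra_history_F int_inner)
  moreover have "AE w in P. real_cond_exp P (F k) ?H w = real_cond_exp P (F k) (\<lambda>_. 0) w"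
    using centered(2) by (intro Fk.real_cond_exp_cong) auto
  moreover have "AE w in P. real_cond_exp P (F k) (\<lambda>_. 0) w = 0"
    by (intro Fk.real_cond_exp_F_meas) auto
  ultimately show "AE w in P. real_cond_exp P (F k) (\<lambda>w. \<psi> w \<bullet> noise k i w) w = 0"
    by eventually_elim simp
qed

subsection \<open>Moments of the batch noise\<close>

lemma cond_exp_add_noise_powr_le:
  fixes T :: "'w \<Rightarrow> 'a"
  assumes i: "i \<in> {1..B}" and T: "T \<in> borel_measurable (history k i)"
    and int_T: "integrable P (\<lambda>w. norm (T w) powr \<alpha>)"
  shows "AE w in P. real_cond_exp P (F k) (\<lambda>w. norm (T w + c *\<^sub>R noise k i w) powr \<alpha>) w
    \<le> real_cond_exp P (F k) (\<lambda>w. norm (T w) powr \<alpha>) w + (3 * \<bar>c\<bar>) powr \<alpha> * moment_bound k w"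
proof -
  interpret Fk: finite_measure_subalgebra P "F k"
    by (rule finite_measure_subalgebra_F)
  define y where "y = noise k i"
  define \<psi> where "\<psi> w = (\<alpha> * c * norm (T w) powr (\<alpha> - 2)) *\<^sub>R T w" for w
  have [measurable]: "T \<in> borel_measurable P" "y \<in> borel_measurable P"
    using measurable_from_subalg[OF subalgebra_history[OF i] T] noise_measurable_P[OF i]
    by (auto simp: y_def)
  have int_y: "integrable P (\<lambda>w. norm (y w) powr \<alpha>)"
    unfolding y_def by (rule integrable_noise_powr[OF i])
  have \<psi>_measurable: "\<psi> \<in> borel_measurable (history k i)"
    unfolding \<psi>_def using T by measurable
  note cross = cond_exp_inner_noise_eq_0[OF i \<psi>_measurable, folded y_def]
  have "norm (\<psi> w) = \<alpha> * \<bar>c\<bar> * norm (T w) powr (\<alpha> - 1)" for w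
    using \<alpha> by (cases "T w = 0") (simp_all add: \<psi>_def abs_mult powr_diff power2_eq_square)
  then have int_prod: "integrable P (\<lambda>w. norm (\<psi> w) * norm (y w))"
    using \<alpha> int_T int_y by (simp add: mult.assoc integrable_norm_powr_minus_one_mult)
  have int_sum: "integrable P (\<lambda>w. norm (T w + c *\<^sub>R y w) powr \<alpha>)"
    using int_T int_y \<alpha> by (intro integrable_norm_add_powr) (auto simp: powr_mult)
  have "norm (T w + c *\<^sub>R y w) powr \<alpha>
      \<le> norm (T w) powr \<alpha> + \<psi> w \<bullet> y w + (3 * \<bar>c\<bar>) powr \<alpha> * norm (y w) powr \<alpha>" for w
    using norm_add_powr_le[of \<alpha> "T w" "c *\<^sub>R y w"] \<alpha> by (simp add: \<psi>_def powr_mult algebra_simps)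
  note Fk.real_cond_exp_le_linear_combination[OF int_sum int_T cross(1)[OF int_prod] int_y this]
  with cross(2)[OF int_prod] cond_exp_noise_powr_le[OF i, of k, folded y_def] show ?thesis
    unfolding y_def[symmetric]
  proof eventually_elim
    case (elim w)
    have "(3 * \<bar>c\<bar>) powr \<alpha> * real_cond_exp P (F k) (\<lambda>w. norm (y w) powr \<alpha>) w
        \<le> (3 * \<bar>c\<bar>) powr \<alpha> * moment_bound k w"
      using elim(2) by (intro mult_left_mono) auto
    with elim show ?case
      by linarith
  qed
qed

lemma integrable_add_batch_powr:
  fixes S :: "'w \<Rightarrow> 'a"
  assumes "S \<in> borel_measurable P" "integrable P (\<lambda>w. norm (S w) powr \<alpha>)" "n \<le> B"
  shows "integrable P (\<lambda>w. norm (S w + c *\<^sub>R (\<Sum>i\<in>{1..n}. noise k i w)) powr \<alpha>)"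
  using assms(3)
proof (induction n)
  case (Suc n)
  then have i: "Suc n \<in> {1..B}"
    by simp
  have [measurable]: "noise k j \<in> borel_measurable P" if "j \<in> {1..n}" for j
    using that Suc.prems by (intro noise_measurable_P) auto
  have "integrable P
      (\<lambda>w. norm ((S w + c *\<^sub>R (\<Sum>i\<in>{1..n}. noise k i w)) + c *\<^sub>R noise k (Suc n) w) powr \<alpha>)"
  proof (rule integrable_norm_add_powr)
    show "(\<lambda>w. S w + c *\<^sub>R (\<Sum>i\<in>{1..n}. noise k i w)) \<in> borel_measurable P"
      using assms(1) by measurable
    show "integrable P (\<lambda>w. norm (c *\<^sub>R noise k (Suc n) w) powr \<alpha>)"
      using integrable_noise_powr[OF i] by (simp add: powr_mult)
  qed (use Suc noise_measurable_P[OF i] \<alpha> in auto)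
  then show ?case
    by (simp add: scaleR_add_right add.assoc)
qed (use assms(2) in simp)

lemma cond_exp_add_batch_powr_le:
  fixes S :: "'w \<Rightarrow> 'a"
  assumes S: "S \<in> borel_measurable (F k)" "integrable P (\<lambda>w. norm (S w) powr \<alpha>)" and "n \<le> B"
  shows "AE w in P. real_cond_exp P (F k) (\<lambda>w. norm (S w + c *\<^sub>R (\<Sum>i\<in>{1..n}. noise k i w)) powr \<alpha>) w
    \<le> norm (S w) powr \<alpha> + n * ((3 * \<bar>c\<bar>) powr \<alpha> * moment_bound k w)"
  using \<open>n \<le> B\<close>
proof (induction n)
  case 0
  interpret Fk: finite_measure_subalgebra P "F k"
    by (rule finite_measure_subalgebra_F)
  have "AE w in P. real_cond_exp P (F k) (\<lambda>w. norm (S w) powr \<alpha>) w = norm (S w) powr \<alpha>"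
    using S by (intro Fk.real_cond_exp_F_meas) auto
  then show ?case
    by eventually_elim simp
next
  case (Suc n)
  then have i: "Suc n \<in> {1..B}" and "n \<le> B"
    by auto
  define T where "T w = S w + c *\<^sub>R (\<Sum>i\<in>{1..n}. noise k i w)" for w
  have T_Suc: "S w + c *\<^sub>R (\<Sum>i\<in>{1..Suc n}. noise k i w) = T w + c *\<^sub>R noise k (Suc n) w" for w
    by (simp add: T_def scaleR_add_right)
  have "noise k j \<in> borel_measurable (history k (Suc n))" if "j \<in> {1..n}" for j
    unfolding noise_def using that
    by (intro borel_measurable_diff measurable_history_G
        measurable_from_subalg[OF subalgebra_history_F] D_meas) auto
  then have T_meas: "T \<in> borel_measurable (history k (Suc n))"
    unfolding T_def
    by (intro borel_measurable_add borel_measurable_scaleR borel_measurable_const borel_measurable_sum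
        measurable_from_subalg[OF subalgebra_history_F S(1)])
  have "integrable P (\<lambda>w. norm (T w) powr \<alpha>)"
    unfolding T_def
    using measurable_from_subalg[OF F_sub S(1)] S(2) \<open>n \<le> B\<close> by (rule integrable_add_batch_powr)
  from cond_exp_add_noise_powr_le[OF i T_meas this, of c] Suc.IH[OF \<open>n \<le> B\<close>, folded T_def]
  show ?case
    unfolding T_Suc by eventually_elim (simp add: algebra_simps)
qed

lemma expectation_potential_step:
  fixes S :: "'w \<Rightarrow> 'a"
  assumes S: "S \<in> borel_measurable (F k)" "integrable P (\<lambda>w. norm (S w) powr \<alpha>)" and A: "0 \<le> A"
  shows "(\<integral>w. (A + norm (S w + c *\<^sub>R (\<Sum>i\<in>{1..B}. noise k i w)) powr \<alpha>) powr (1/\<alpha>) \<partial>P)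
    \<le> (\<integral>w. (A + B * (3 * \<bar>c\<bar> * \<sigma>0) powr \<alpha> + norm (S w) powr \<alpha>) powr (1/\<alpha>) \<partial>P)
      + 3 * \<bar>c\<bar> * B powr (1/\<alpha>) * \<sigma>1 * (\<integral>w. norm (D k w) \<partial>P)"
proof -
  interpret Fk: finite_measure_subalgebra P "F k"
    by (rule finite_measure_subalgebra_F)
  define Z where "Z w = A + norm (S w + c *\<^sub>R (\<Sum>i\<in>{1..B}. noise k i w)) powr \<alpha>" for w
  define U where "U w = A + B * (3 * \<bar>c\<bar> * \<sigma>0) powr \<alpha> + norm (S w) powr \<alpha>" for w
  define V where "V w = B * (3 * \<bar>c\<bar> * \<sigma>1 * norm (D k w)) powr \<alpha>" for w
  have nonneg: "0 \<le> Z w" "0 \<le> U w" "0 \<le> V w" for w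
    using A by (simp_all add: Z_def U_def V_def)
  have int_batch: "integrable P (\<lambda>w. norm (S w + c *\<^sub>R (\<Sum>i\<in>{1..B}. noise k i w)) powr \<alpha>)"
    using measurable_from_subalg[OF F_sub S(1)] S(2) order_refl by (rule integrable_add_batch_powr)
  have int_Z: "integrable P Z"
    unfolding Z_def using int_batch by simp
  have int_U: "integrable P (\<lambda>w. U w powr (1/\<alpha>))"
    using S(2) A \<alpha> unfolding U_def by (intro integrable_powr_le_one) auto
  have V_root: "V w powr (1/\<alpha>) = 3 * \<bar>c\<bar> * B powr (1/\<alpha>) * \<sigma>1 * norm (D k w)" for w
    using \<sigma> \<alpha> by (simp add: V_def powr_mult powr_powr mult_ac)
  have split: "A + (norm (S w) powr \<alpha> + B * ((3 * \<bar>c\<bar>) powr \<alpha> * moment_bound k w)) = U w + V w" for w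
    using \<sigma> by (simp add: U_def V_def moment_bound_def powr_mult algebra_simps)
  have "AE w in P. real_cond_exp P (F k) Z w = real_cond_exp P (F k) (\<lambda>_. A) w
      + real_cond_exp P (F k) (\<lambda>w. norm (S w + c *\<^sub>R (\<Sum>i\<in>{1..B}. noise k i w)) powr \<alpha>) w"
    unfolding Z_def by (intro Fk.real_cond_exp_add int_batch) simp
  moreover have "AE w in P. real_cond_exp P (F k) (\<lambda>_. A) w = A"
    by (intro Fk.real_cond_exp_F_meas) auto
  moreover note cond_exp_add_batch_powr_le[OF S order_refl, of c]
  ultimately have "AE w in P. real_cond_exp P (F k) Z w \<le> U w + V w"
    by eventually_elim (simp flip: split)
  then have "(\<integral>w. Z w powr (1/\<alpha>) \<partial>P) \<le> (\<integral>w. U w powr (1/\<alpha>) \<partial>P) + (\<integral>w. V w powr (1/\<alpha>) \<partial>P)"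
    using int_Z int_U nonneg \<alpha> integrable_D
    by (intro Fk.integral_powr_le_add_powr) (auto simp: V_root)
  then show ?thesis
    unfolding V_root by (simp add: Z_def U_def)
qed

definition weighted_noise :: "(nat \<Rightarrow> real) \<Rightarrow> nat \<Rightarrow> 'w \<Rightarrow> 'a" where
  "weighted_noise c n w = (\<Sum>j<n. c j *\<^sub>R (\<Sum>i\<in>{1..B}. noise j i w))"

lemma weighted_noise_Suc:
  "weighted_noise c (Suc n) w = weighted_noise c n w + c n *\<^sub>R (\<Sum>i\<in>{1..B}. noise n i w)"
  by (simp add: weighted_noise_def)

lemma weighted_noise_measurable: "weighted_noise c n \<in> borel_measurable (F n)"
proof -
  have "noise j i \<in> borel_measurable (F n)" if "i \<in> {1..B}" "j < n" for i j
    unfolding noise_def using that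
    by (intro borel_measurable_diff measurable_F_mono[OF G_meas] measurable_F_mono[OF D_meas]) auto
  then show ?thesis
    unfolding weighted_noise_def
    by (intro borel_measurable_sum borel_measurable_scaleR borel_measurable_const) auto
qed

lemma integrable_weighted_noise: "integrable P (weighted_noise c n)"
  unfolding weighted_noise_def
  by (intro Bochner_Integration.integrable_sum integrable_scaleR_right integrable_noise)

lemma integrable_weighted_noise_powr: "integrable P (\<lambda>w. norm (weighted_noise c n w) powr \<alpha>)"
proof (induction n)
  case (Suc n)
  then show ?case
    unfolding weighted_noise_Suc
    using measurable_from_subalg[OF F_sub weighted_noise_measurable]
    by (intro integrable_add_batch_powr) auto
qed (simp add: weighted_noise_def)

lemma expectation_potential_weighted_noise_le:
  assumes "0 \<le> A"
  shows "(\<integral>w. (A + norm (weighted_noise c n w) powr \<alpha>) powr (1/\<alpha>) \<partial>P)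
    \<le> (A + B * (\<Sum>j<n. (3 * \<bar>c j\<bar> * \<sigma>0) powr \<alpha>)) powr (1/\<alpha>)
      + 3 * B powr (1/\<alpha>) * \<sigma>1 * (\<Sum>j<n. \<bar>c j\<bar> * (\<integral>w. norm (D j w) \<partial>P))"
  using assms
proof (induction n arbitrary: A)
  case 0
  then show ?case
    by (simp add: weighted_noise_def prob_space)
next
  case (Suc n)
  let ?A = "A + B * (3 * \<bar>c n\<bar> * \<sigma>0) powr \<alpha>"
  have "(\<integral>w. (A + norm (weighted_noise c (Suc n) w) powr \<alpha>) powr (1/\<alpha>) \<partial>P)
      \<le> (\<integral>w. (?A + norm (weighted_noise c n w) powr \<alpha>) powr (1/\<alpha>) \<partial>P)
        + 3 * \<bar>c n\<bar> * B powr (1/\<alpha>) * \<sigma>1 * (\<integral>w. norm (D n w) \<partial>P)"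
    unfolding weighted_noise_Suc
    by (rule expectation_potential_step[OF weighted_noise_measurable integrable_weighted_noise_powr
          Suc.prems])
  also have "(\<integral>w. (?A + norm (weighted_noise c n w) powr \<alpha>) powr (1/\<alpha>) \<partial>P)
      \<le> (?A + B * (\<Sum>j<n. (3 * \<bar>c j\<bar> * \<sigma>0) powr \<alpha>)) powr (1/\<alpha>)
        + 3 * B powr (1/\<alpha>) * \<sigma>1 * (\<Sum>j<n. \<bar>c j\<bar> * (\<integral>w. norm (D j w) \<partial>P))"
    using Suc.prems by (intro Suc.IH) simp
  finally show ?case
    by (simp add: algebra_simps)
qed

lemma expectation_norm_weighted_noise_le:
  "(\<integral>w. norm (weighted_noise c n w) \<partial>P)
    \<le> 3 * B powr (1/\<alpha>) * (\<sigma>0 * (\<Sum>j<n. \<bar>c j\<bar> powr \<alpha>) powr (1/\<alpha>)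
         + \<sigma>1 * (\<Sum>j<n. \<bar>c j\<bar> * (\<integral>w. norm (D j w) \<partial>P)))"
proof -
  have "(\<Sum>j<n. (3 * \<bar>c j\<bar> * \<sigma>0) powr \<alpha>) = (3 * \<sigma>0) powr \<alpha> * (\<Sum>j<n. \<bar>c j\<bar> powr \<alpha>)"
    using \<sigma> by (simp add: powr_mult sum_distrib_left mult_ac)
  moreover have "((3 * \<sigma>0) powr \<alpha>) powr (1/\<alpha>) = 3 * \<sigma>0"
    using \<sigma> \<alpha> by (simp add: powr_powr)
  ultimately have "(B * (\<Sum>j<n. (3 * \<bar>c j\<bar> * \<sigma>0) powr \<alpha>)) powr (1/\<alpha>)
      = 3 * B powr (1/\<alpha>) * \<sigma>0 * (\<Sum>j<n. \<bar>c j\<bar> powr \<alpha>) powr (1/\<alpha>)"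
    by (simp only:) (simp add: powr_mult sum_nonneg)
  then show ?thesis
    using expectation_potential_weighted_noise_le[of 0 c n] \<alpha> by (simp add: powr_powr algebra_simps)
qed

end

section \<open>Von Bahr--Esseen constants\<close>

lemma (in prob_space) indep_vars_singleton:
  assumes "random_variable (N i) (Y i)"
  shows "indep_vars N Y {i}"
  unfolding indep_vars_def2 indep_sets_def
proof (intro conjI ballI allI impI)
  fix J A assume "J \<subseteq> {i}" "J \<noteq> {}"
  then have "J = {i}"
    by blast
  then show "prob (\<Inter> (A ` J)) = (\<Prod>j\<in>J. prob (A j))"
    by simp
qed (use assms in \<open>auto intro: measurable_sets\<close>)

text \<open>A single Rademacher sign times a unit matrix already forces \<open>C \<ge> 1\<close>.\<close>

lemma vbe_constant_ge_1:
  assumes vbe: "vbe_constant \<alpha> C TYPE('n::finite) TYPE('m::finite)"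
  shows "1 \<le> C"
proof -
  define e :: "real^'n^'m" where "e = axis undefined (axis undefined 1)"
  have norm_e: "norm e = 1"
    by (simp add: e_def norm_eq_sqrt_inner inner_axis_axis)
  define g :: "bool \<Rightarrow> nat \<Rightarrow> real^'n^'m" where "g b = (\<lambda>_. if b then e else - e)" for b
  define Q where "Q = measure_pmf (map_pmf g (pmf_of_set UNIV))"
  define Y :: "nat \<Rightarrow> (nat \<Rightarrow> real^'n^'m) \<Rightarrow> real^'n^'m" where "Y i x = x 0" for i x
  interpret Q: prob_space Q
    unfolding Q_def by (rule prob_space_measure_pmf)
  have "integrable Q (Y i)" for i
    unfolding Q_def by (intro integrable_measure_pmf_finite) auto
  moreover have "(\<integral>x. Y i x \<partial>Q) = 0" for i
    unfolding Q_def by (simp add: Y_def g_def integral_measure_pmf[of UNIV] UNIV_bool)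
  moreover have moment: "(\<integral>\<^sup>+x. ennreal (norm (Y i x) powr \<alpha>) \<partial>Q) = 1" for i
  proof -
    have "(\<integral>\<^sup>+x. ennreal (norm (Y i x) powr \<alpha>) \<partial>Q)
        = (\<integral>\<^sup>+b. 1 \<partial>measure_pmf (pmf_of_set (UNIV :: bool set)))"
      unfolding Q_def nn_integral_map_pmf
      by (intro nn_integral_cong) (auto simp: Y_def g_def norm_e)
    then show ?thesis
      by simp
  qed
  moreover have "{..<1} = {0::nat}"
    by auto
  then have "Q.indep_vars (\<lambda>_. borel) Y {..<1}"
    using Q.indep_vars_singleton[where N = "\<lambda>_. borel" and Y = Y and i = 0] by (simp add: Q_def)
  ultimately have "(\<integral>\<^sup>+x. ennreal (norm (\<Sum>i<1. Y i x) powr \<alpha>) \<partial>Q)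
      \<le> ennreal C * (\<Sum>i<1. \<integral>\<^sup>+x. ennreal (norm (Y i x) powr \<alpha>) \<partial>Q)"
    using vbe[unfolded vbe_constant_def, rule_format, of Q Y 1] Q.prob_space_axioms by simp
  then show ?thesis
    by (simp add: moment ennreal_ge_1)
qed

lemma three_le_vbe_constant:
  assumes "vbe_constant \<alpha> C TYPE('n::finite) TYPE('m::finite)" "0 < \<alpha>"
  shows "3 \<le> 2 * sqrt pi * C powr (1/\<alpha>)"
proof -
  have "3/2 \<le> sqrt pi"
    using pi_gt3 by (intro real_le_rsqrt) (simp add: power2_eq_square)
  moreover have "1 \<le> C powr (1/\<alpha>)"
    using vbe_constant_ge_1[OF assms(1)] assms(2) by (intro ge_one_powr_ge_zero) auto
  ultimately have "3/2 * 1 \<le> sqrt pi * C powr (1/\<alpha>)"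
    by (intro mult_mono) auto
  then show ?thesis
    by simp
qed

section \<open>The momentum error\<close>

lemma muon_error_Suc:
  fixes Gb g :: "nat \<Rightarrow> real^'n^'m" and C :: "real^'n^'m" and \<beta> :: real
  defines "S \<equiv> \<lambda>k. (1 - \<beta>) *\<^sub>R muon_M \<beta> C Gb k - g k"
  shows "S (Suc k) = \<beta> *\<^sub>R S k + \<beta>\<^sup>2 *\<^sub>R (g k - g (Suc k))
    + (1 - \<beta>) *\<^sub>R ((1 + \<beta>) *\<^sub>R (Gb (Suc k) - g (Suc k)) - \<beta> *\<^sub>R (Gb k - g k))"
  unfolding S_def muon_M_def muon_C_def muon_Cprev.simps
  by (simp add: vec_eq_iff algebra_simps power2_eq_square)

text \<open>
  \<open>(1 - \<beta>) * muon_weight \<beta> k j\<close> is the coefficient of the \<open>j\<close>-th batch noise when the recursion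
  above is unrolled and the contribution of the initial error is kept separate.
\<close>

primrec muon_weight :: "real \<Rightarrow> nat \<Rightarrow> nat \<Rightarrow> real" where
  "muon_weight \<beta> 0 j = 0"
| "muon_weight \<beta> (Suc k) j =
     \<beta> * muon_weight \<beta> k j + (if j = Suc k then 1 + \<beta> else 0) - (if j = k then \<beta> else 0)"

lemma muon_weight_eq:
  "muon_weight \<beta> k j =
     (if k = 0 \<or> k < j then 0 else if j = k then 1 + \<beta>
      else if j = 0 then - (\<beta> ^ k) else \<beta> ^ (k - j + 1))"
proof (induction k)
  case (Suc k)
  have "Suc k - j + 1 = Suc (k - j + 1)" if "j \<le> k"
    using that by simp
  then show ?case
    unfolding muon_weight.simps Suc
    by (auto simp: algebra_simps not_less power2_eq_square Suc_diff_le)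
qed simp

lemma sum_muon_weight_row_le:
  assumes "0 < \<beta>" "\<beta> < 1"
  shows "(\<Sum>j<k. \<bar>muon_weight \<beta> k j\<bar>) \<le> \<beta> / (1 - \<beta>)"
proof (induction k)
  case 0
  show ?case
    using assms by simp
next
  case (Suc k)
  have row: "(\<Sum>j<Suc k. \<bar>muon_weight \<beta> (Suc k) j\<bar>)
      = \<beta> * (\<Sum>j<k. \<bar>muon_weight \<beta> k j\<bar>) + \<bar>muon_weight \<beta> (Suc k) k\<bar>"
    using assms by (simp add: sum_distrib_left abs_mult)
  show ?case
  proof (cases "k = 0")
    case True
    then show ?thesis
      using assms by (simp add: field_simps)
  next
    case False
    then have "\<bar>muon_weight \<beta> (Suc k) k\<bar> = \<beta>\<^sup>2"
      using assms by (simp add: muon_weight_eq power2_eq_square)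
    then have "(\<Sum>j<Suc k. \<bar>muon_weight \<beta> (Suc k) j\<bar>) \<le> \<beta> * (\<beta> / (1 - \<beta>)) + \<beta>\<^sup>2"
      using row mult_left_mono[OF Suc, of \<beta>] assms by linarith
    also have "\<dots> = \<beta> / (1 - \<beta>) * (1 - (1 - \<beta>)\<^sup>2)"
      using assms by (simp add: field_simps power2_eq_square)
    also have "\<dots> \<le> \<beta> / (1 - \<beta>) * 1"
      using assms by (intro mult_left_mono) auto
    finally show ?thesis
      by simp
  qed
qed

lemma sum_muon_weight_powr_le:
  assumes "0 < \<beta>" "\<beta> < 1" "1 \<le> \<alpha>"
  shows "(\<Sum>j<Suc k. \<bar>muon_weight \<beta> k j\<bar> powr \<alpha>) \<le> (2 powr \<alpha> + 1) / (1 - \<beta>)"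
proof -
  have "\<bar>muon_weight \<beta> k j\<bar> powr \<alpha> \<le> \<bar>muon_weight \<beta> k j\<bar>" if "j < k" for j
  proof -
    have "\<bar>muon_weight \<beta> k j\<bar> \<le> 1"
      using assms that by (auto simp: muon_weight_eq power_le_one mult_le_one)
    then show ?thesis
      using powr_mono'[of 1 \<alpha> "\<bar>muon_weight \<beta> k j\<bar>"] assms by simp
  qed
  then have "(\<Sum>j<k. \<bar>muon_weight \<beta> k j\<bar> powr \<alpha>) \<le> (\<Sum>j<k. \<bar>muon_weight \<beta> k j\<bar>)"
    by (intro sum_mono) auto
  also have "\<dots> \<le> \<beta> / (1 - \<beta>)"
    using assms by (intro sum_muon_weight_row_le)
  also have "\<dots> \<le> 1 / (1 - \<beta>)"
    using assms by (intro divide_right_mono) auto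
  finally have "(\<Sum>j<k. \<bar>muon_weight \<beta> k j\<bar> powr \<alpha>) \<le> 1 / (1 - \<beta>)" .
  moreover have "\<bar>muon_weight \<beta> k k\<bar> powr \<alpha> \<le> 2 powr \<alpha>"
    using assms by (intro powr_mono2) (auto simp: muon_weight_eq)
  moreover have "2 powr \<alpha> \<le> 2 powr \<alpha> / (1 - \<beta>)"
    using assms by (simp add: field_simps)
  ultimately show ?thesis
    by (simp add: add_divide_distrib)
qed

lemma sum_muon_weight_first_column_le:
  assumes "0 < \<beta>" "\<beta> < 1"
  shows "(1 - \<beta>) * (\<Sum>k<K. \<bar>muon_weight \<beta> k 0\<bar>) \<le> (if K = 0 then 0 else \<beta> - \<beta> ^ K)"
proof (induction K)
  case (Suc K)
  then show ?case
    using assms by (auto simp: muon_weight_eq algebra_simps split: if_splits)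
qed simp

lemma sum_muon_weight_later_column_le:
  assumes "0 < \<beta>" "\<beta> < 1" "0 < j"
  shows "(1 - \<beta>) * (\<Sum>k<K. \<bar>muon_weight \<beta> k j\<bar>) \<le> (if K \<le> j then 0 else 1 - \<beta> ^ (K - j + 1))"
proof (induction K)
  case (Suc K)
  consider "K < j" | "K = j" | "j < K"
    by linarith
  then show ?case
  proof cases
    case 1
    then show ?thesis
      using Suc by (simp add: muon_weight_eq)
  next
    case 2
    then show ?thesis
      using Suc assms by (simp add: muon_weight_eq algebra_simps power2_eq_square)
  next
    case 3
    then have "Suc K - j + 1 = Suc (K - j + 1)"
      by simp
    then show ?thesis
      using Suc assms 3 by (simp add: muon_weight_eq algebra_simps abs_mult)
  qed
qed simp

lemma sum_muon_weight_column_le: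
  assumes "0 < \<beta>" "\<beta> < 1"
  shows "(1 - \<beta>) * (\<Sum>k<K. \<bar>muon_weight \<beta> k j\<bar>) \<le> 1"
proof (cases "j = 0")
  case True
  have "(if K = 0 then 0 else \<beta> - \<beta> ^ K) \<le> 1"
    using assms by (auto intro: order_trans[of _ \<beta>])
  with sum_muon_weight_first_column_le[OF assms, of K] show ?thesis
    using True by simp
next
  case False
  have "(if K \<le> j then 0 else 1 - \<beta> ^ (K - j + 1)) \<le> 1"
    using assms by simp
  with sum_muon_weight_later_column_le[OF assms, of j K] show ?thesis
    using False by simp
qed

lemma muon_error_eq:
  fixes Gb g :: "nat \<Rightarrow> real^'n^'m" and C :: "real^'n^'m" and \<beta> :: real
  defines "S \<equiv> \<lambda>k. (1 - \<beta>) *\<^sub>R muon_M \<beta> C Gb k - g k"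
  shows "S k = \<beta> ^ k *\<^sub>R S 0 + \<beta>\<^sup>2 *\<^sub>R (\<Sum>j<k. \<beta> ^ (k - Suc j) *\<^sub>R (g j - g (Suc j)))
    + (1 - \<beta>) *\<^sub>R (\<Sum>j<Suc k. muon_weight \<beta> k j *\<^sub>R (Gb j - g j))"
proof (induction k)
  case 0
  show ?case
    by simp
next
  case (Suc k)
  define drift where "drift k = (\<Sum>j<k. \<beta> ^ (k - Suc j) *\<^sub>R (g j - g (Suc j)))" for k
  define noise where "noise k = (\<Sum>j<Suc k. muon_weight \<beta> k j *\<^sub>R (Gb j - g j))" for k
  have "\<beta> ^ (k - j) = \<beta> * \<beta> ^ (k - Suc j)" if "j < k" for j
    using that by (simp flip: power_Suc add: Suc_diff_Suc)
  then have drift_Suc: "drift (Suc k) = \<beta> *\<^sub>R drift k + (g k - g (Suc k))"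
    by (simp add: drift_def scaleR_sum_right)
  have noise_Suc: "noise (Suc k)
      = \<beta> *\<^sub>R noise k + ((1 + \<beta>) *\<^sub>R (Gb (Suc k) - g (Suc k)) - \<beta> *\<^sub>R (Gb k - g k))"
    by (simp add: noise_def scaleR_sum_right scaleR_add_right scaleR_diff_left scaleR_add_left
        muon_weight_eq[of _ _ "Suc _"] algebra_simps)
  have "S (Suc k) = \<beta> *\<^sub>R (\<beta> ^ k *\<^sub>R S 0 + \<beta>\<^sup>2 *\<^sub>R drift k + (1 - \<beta>) *\<^sub>R noise k)
      + \<beta>\<^sup>2 *\<^sub>R (g k - g (Suc k))
      + (1 - \<beta>) *\<^sub>R ((1 + \<beta>) *\<^sub>R (Gb (Suc k) - g (Suc k)) - \<beta> *\<^sub>R (Gb k - g k))"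
    unfolding S_def muon_error_Suc using Suc by (simp add: S_def drift_def noise_def)
  also have "\<dots> = \<beta> ^ Suc k *\<^sub>R S 0 + \<beta>\<^sup>2 *\<^sub>R drift (Suc k) + (1 - \<beta>) *\<^sub>R noise (Suc k)"
    unfolding drift_Suc noise_Suc by (simp add: scaleR_add_right mult_ac)
  finally show ?case
    by (simp only: drift_def noise_def)
qed

section \<open>Muon on smooth objectives\<close>

lemma descent_lemma:
  fixes f :: "'a::real_inner \<Rightarrow> real"
  assumes grad: "\<And>Y. (f has_derivative (\<lambda>H. g Y \<bullet> H)) (at Y)"
    and smooth: "\<And>Y Z. norm (g Y - g Z) \<le> L * norm (Y - Z)"
  shows "f (Y + H) \<le> f Y + g Y \<bullet> H + L / 2 * (norm H)\<^sup>2"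
proof -
  define \<phi> where "\<phi> t = f (Y + t *\<^sub>R H) - t * (g Y \<bullet> H) - L / 2 * t\<^sup>2 * (norm H)\<^sup>2" for t
  have deriv: "(\<phi> has_real_derivative ((g (Y + t *\<^sub>R H) - g Y) \<bullet> H - L * t * (norm H)\<^sup>2)) (at t)" for t
  proof -
    have "((\<lambda>t. Y + t *\<^sub>R H) has_derivative (\<lambda>s. s *\<^sub>R H)) (at t)"
      by (auto intro!: derivative_eq_intros)
    from has_derivative_compose[OF this grad]
    have "((\<lambda>t. f (Y + t *\<^sub>R H)) has_real_derivative g (Y + t *\<^sub>R H) \<bullet> H) (at t)"
      unfolding has_field_derivative_def by (rule has_derivative_eq_rhs) (auto simp: fun_eq_iff)
    then show ?thesis
      unfolding \<phi>_def by (auto intro!: derivative_eq_intros simp: inner_diff_left algebra_simps)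
  qed
  have "\<phi> 1 \<le> \<phi> 0"
  proof (rule DERIV_nonpos_imp_nonincreasing[where f = \<phi> and a = 0 and b = 1])
    fix t :: real assume t: "0 \<le> t" "t \<le> 1"
    have "(g (Y + t *\<^sub>R H) - g Y) \<bullet> H \<le> norm (g (Y + t *\<^sub>R H) - g Y) * norm H"
      by (rule norm_cauchy_schwarz)
    also have "\<dots> \<le> L * norm (Y + t *\<^sub>R H - Y) * norm H"
      by (intro mult_right_mono smooth) auto
    also have "\<dots> = L * t * (norm H)\<^sup>2"
      using t by (simp add: power2_eq_square)
    finally show "\<exists>y. (\<phi> has_real_derivative y) (at t) \<and> y \<le> 0"
      using deriv[of t] by (intro exI conjI) auto
  qed simp
  then show ?thesis
    by (simp add: \<phi>_def)
qed

locale muon =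
  fixes f :: "real^'n::finite^'m::finite \<Rightarrow> real" and gradf :: "real^'n^'m \<Rightarrow> real^'n^'m"
    and fstar L \<eta> \<beta> d :: real and X0 Cm1 :: "real^'n^'m"
  assumes grad: "\<And>Y. (f has_derivative (\<lambda>H. gradf Y \<bullet> H)) (at Y)"
    and lower: "\<And>Y. fstar \<le> f Y"
    and smooth: "\<And>Y Z. norm (gradf Y - gradf Z) \<le> L * norm (Y - Z)"
    and \<eta>: "0 < \<eta>"
    and \<beta>: "0 < \<beta>" "\<beta> < 1"
    and d_eq: "d = real (min CARD('m) CARD('n))"
begin

lemma L_nonneg: "0 \<le> L"
proof -
  have "0 < norm (1 :: real^'n^'m)"
    by (simp add: vec_eq_iff)
  moreover have "0 \<le> L * norm (1 - 0 :: real^'n^'m)"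
    using smooth[of 1 0] norm_ge_zero order_trans by blast
  ultimately show ?thesis
    by (simp add: zero_le_mult_iff)
qed

lemma borel_measurable_gradf: "gradf \<in> borel_measurable borel"
proof (rule borel_measurable_continuous_onI)
  show "continuous_on UNIV gradf"
    using smooth L_nonneg
    by (intro lipschitz_on_continuous_on[of L] lipschitz_onI) (auto simp: dist_norm)
qed

lemma d_nonneg: "0 \<le> d"
  by (simp add: d_eq)

lemma norm_polar_le_sqrt_d: "norm (polar M :: real^'n^'m) \<le> sqrt d"
  unfolding d_eq by (rule norm_polar_le)

abbreviation iterate :: "(nat \<Rightarrow> real^'n^'m) \<Rightarrow> nat \<Rightarrow> real^'n^'m" where
  "iterate Gb k \<equiv> muon_X \<eta> \<beta> X0 Cm1 Gb k"

definition momentum_error :: "(nat \<Rightarrow> real^'n^'m) \<Rightarrow> nat \<Rightarrow> real^'n^'m" where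
  "momentum_error Gb k = (1 - \<beta>) *\<^sub>R muon_M \<beta> Cm1 Gb k - gradf (iterate Gb k)"

lemma norm_gradf_diff_iterate_le:
  "norm (gradf (iterate Gb k) - gradf (iterate Gb (Suc k))) \<le> L * \<eta> * sqrt d"
proof -
  have "norm (gradf (iterate Gb k) - gradf (iterate Gb (Suc k)))
      \<le> L * norm (\<eta> *\<^sub>R polar (muon_M \<beta> Cm1 Gb k))"
    using smooth[of "iterate Gb k" "iterate Gb (Suc k)"] by simp
  also have "\<dots> \<le> L * (\<eta> * sqrt d)"
    using norm_polar_le_sqrt_d \<eta> L_nonneg by (simp add: mult_left_mono)
  finally show ?thesis
    by (simp add: mult.assoc)
qed

lemma norm_gradf_iterate_le: "norm (gradf (iterate Gb k)) \<le> norm (gradf X0) + k * (L * \<eta> * sqrt d)"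
proof (induction k)
  case (Suc k)
  have "norm (gradf (iterate Gb (Suc k)))
      \<le> norm (gradf (iterate Gb k)) + norm (gradf (iterate Gb k) - gradf (iterate Gb (Suc k)))"
    by (metis norm_minus_commute norm_triangle_sub add.commute)
  with Suc norm_gradf_diff_iterate_le[of Gb k] show ?case
    by (simp add: algebra_simps)
qed simp

lemma norm_gradf_le_inner_polar:
  assumes "0 \<le> c"
  shows "norm (gradf Y) - (1 + sqrt d) * norm (c *\<^sub>R M - gradf Y) \<le> gradf Y \<bullet> polar M"
proof -
  have "(c *\<^sub>R M - gradf Y) \<bullet> polar M \<le> norm (c *\<^sub>R M - gradf Y) * norm (polar M)"
    by (rule norm_cauchy_schwarz)
  also have "\<dots> \<le> norm (c *\<^sub>R M - gradf Y) * sqrt d"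
    by (intro mult_left_mono norm_polar_le_sqrt_d) auto
  finally have "c * (M \<bullet> polar M) - norm (c *\<^sub>R M - gradf Y) * sqrt d \<le> gradf Y \<bullet> polar M"
    by (simp add: inner_diff_left)
  moreover have "norm (c *\<^sub>R M) \<le> c * (M \<bullet> polar M)"
    using assms by (simp add: mult_left_mono norm_le_inner_polar)
  moreover have "norm (gradf Y) \<le> norm (c *\<^sub>R M) + norm (c *\<^sub>R M - gradf Y)"
    by (metis norm_minus_commute norm_triangle_sub add.commute)
  ultimately show ?thesis
    by (simp add: algebra_simps)
qed

lemma polar_step_descent:
  assumes "0 \<le> c"
  shows "f (Y - \<eta> *\<^sub>R polar M) \<le> f Y - \<eta> * norm (gradf Y)
    + \<eta> * (1 + sqrt d) * norm (c *\<^sub>R M - gradf Y) + L * d * \<eta>\<^sup>2 / 2"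
proof -
  have "(norm (polar M))\<^sup>2 \<le> d"
    using norm_polar_le_sqrt_d[of M] d_nonneg by (simp add: sqrt_ge_absD)
  then have "L / 2 * (\<eta>\<^sup>2 * (norm (polar M))\<^sup>2) \<le> L / 2 * (\<eta>\<^sup>2 * d)"
    using L_nonneg by (intro mult_left_mono) auto
  moreover have "f (Y + (- \<eta>) *\<^sub>R polar M)
      \<le> f Y + gradf Y \<bullet> ((- \<eta>) *\<^sub>R polar M) + L / 2 * (norm ((- \<eta>) *\<^sub>R polar M))\<^sup>2"
    by (rule descent_lemma[OF grad smooth])
  moreover have "\<eta> * (norm (gradf Y) - (1 + sqrt d) * norm (c *\<^sub>R M - gradf Y))
      \<le> \<eta> * (gradf Y \<bullet> polar M)"
    using norm_gradf_le_inner_polar[OF assms] \<eta> by (intro mult_left_mono) auto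
  ultimately show ?thesis
    by (simp add: power_mult_distrib algebra_simps)
qed

lemma sum_norm_gradf_iterate_le:
  "\<eta> * (\<Sum>k<K. norm (gradf (iterate Gb k)))
    \<le> f X0 - fstar + \<eta> * (1 + sqrt d) * (\<Sum>k<K. norm (momentum_error Gb k)) + K * (L * d * \<eta>\<^sup>2 / 2)"
proof -
  have "\<eta> * norm (gradf (iterate Gb k)) \<le> f (iterate Gb k) - f (iterate Gb (Suc k))
      + \<eta> * (1 + sqrt d) * norm (momentum_error Gb k) + L * d * \<eta>\<^sup>2 / 2" for k
    using polar_step_descent[of "1 - \<beta>" "iterate Gb k" "muon_M \<beta> Cm1 Gb k"] \<beta>
    by (simp add: momentum_error_def)
  then have "\<eta> * (\<Sum>k<K. norm (gradf (iterate Gb k))) \<le> (\<Sum>k<K. f (iterate Gb k) - f (iterate Gb (Suc k))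
      + \<eta> * (1 + sqrt d) * norm (momentum_error Gb k) + L * d * \<eta>\<^sup>2 / 2)"
    unfolding sum_distrib_left by (intro sum_mono)
  also have "\<dots> = (f (iterate Gb 0) - f (iterate Gb K))
      + \<eta> * (1 + sqrt d) * (\<Sum>k<K. norm (momentum_error Gb k)) + K * (L * d * \<eta>\<^sup>2 / 2)"
    by (simp only: sum.distrib sum_distrib_left[symmetric] 
        sum_lessThan_telescope'[of "\<lambda>k. f (iterate Gb k)"] sum_constant card_lessThan)
  finally show ?thesis
    using lower[of "iterate Gb K"] by simp
qed

lemma norm_momentum_error_le:
  "norm (momentum_error Gb k) \<le> \<beta> ^ k * norm (momentum_error Gb 0) + \<beta>\<^sup>2 * (L * \<eta> * sqrt d) / (1 - \<beta>)
    + norm ((1 - \<beta>) *\<^sub>R (\<Sum>j<Suc k. muon_weight \<beta> k j *\<^sub>R (Gb j - gradf (iterate Gb j))))"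
proof -
  define drift
    where "drift = (\<Sum>j<k. \<beta> ^ (k - Suc j) *\<^sub>R (gradf (iterate Gb j) - gradf (iterate Gb (Suc j))))"
  define noise
    where "noise = (1 - \<beta>) *\<^sub>R (\<Sum>j<Suc k. muon_weight \<beta> k j *\<^sub>R (Gb j - gradf (iterate Gb j)))"
  have "norm drift \<le> (\<Sum>j<k. \<beta> ^ (k - Suc j) * (L * \<eta> * sqrt d))"
    unfolding drift_def using norm_gradf_diff_iterate_le \<beta>
    by (intro sum_norm_le) (simp add: mult_left_mono del: muon_X.simps)
  also have "\<dots> = (\<Sum>j<k. \<beta> ^ j) * (L * \<eta> * sqrt d)"
    unfolding sum_distrib_right by (rule sum.nat_diff_reindex)
  also have "\<dots> \<le> 1 / (1 - \<beta>) * (L * \<eta> * sqrt d)"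
    using geometric_sum_less[OF \<beta>, of "{..<k}"] L_nonneg \<eta> d_nonneg by (intro mult_right_mono) auto
  finally have drift_le: "\<beta>\<^sup>2 * norm drift \<le> \<beta>\<^sup>2 * (1 / (1 - \<beta>) * (L * \<eta> * sqrt d))"
    by (intro mult_left_mono) auto
  have "momentum_error Gb k = \<beta> ^ k *\<^sub>R momentum_error Gb 0 + \<beta>\<^sup>2 *\<^sub>R drift + noise"
    unfolding momentum_error_def drift_def noise_def by (rule muon_error_eq)
  also have "norm \<dots> \<le> norm (\<beta> ^ k *\<^sub>R momentum_error Gb 0) + norm (\<beta>\<^sup>2 *\<^sub>R drift) + norm noise"
    by (intro norm_triangle_le add_right_mono norm_triangle_ineq)
  finally show ?thesis
    using drift_le \<beta> by (simp add: noise_def)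
qed

end

lemma borel_measurable_muon_X:
  fixes Gb :: "'w \<Rightarrow> nat \<Rightarrow> real^'n^'m"
  assumes F_sub: "\<And>k. subalgebra P (F k)" and F_mono: "\<And>k. sets (F k) \<subseteq> sets (F (Suc k))"
    and Gb: "\<And>k. (\<lambda>w. Gb w k) \<in> borel_measurable (F (Suc k))"
  shows "(\<lambda>w. muon_X \<eta> \<beta> X0 Cm1 (Gb w) k) \<in> borel_measurable (F k)"
proof -
  have F_Suc: "h \<in> borel_measurable (F (Suc k))" if "h \<in> borel_measurable (F k)"
    for h :: "'w \<Rightarrow> real^'n^'m" and k
    by (rule measurable_from_subalg[OF _ that]) (use F_mono F_sub in \<open>auto simp: subalgebra_def\<close>)
  have Cprev: "(\<lambda>w. muon_Cprev \<beta> Cm1 (Gb w) k) \<in> borel_measurable (F k)" for k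
  proof (induction k)
    case (Suc k)
    show ?case
      using Gb F_Suc[OF Suc] by (auto intro!: borel_measurable_add borel_measurable_scaleR)
  qed simp
  have M: "(\<lambda>w. muon_M \<beta> Cm1 (Gb w) k) \<in> borel_measurable (F (Suc k))" for k
    unfolding muon_M_def muon_C_def
    by (intro borel_measurable_add borel_measurable_scaleR borel_measurable_const Gb F_Suc[OF Cprev])
  show ?thesis
  proof (induction k)
    case (Suc k)
    show ?case
      using F_Suc[OF Suc] measurable_compose[OF M borel_measurable_polar]
      by (auto intro!: borel_measurable_diff borel_measurable_scaleR)
  qed simp
qed

lemma integrable_muon_M:
  assumes Gb: "\<And>k. integrable P (\<lambda>w. Gb w k)" and "finite_measure P"
  shows "integrable P (\<lambda>w. muon_M \<beta> Cm1 (Gb w) k)"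
proof -
  interpret finite_measure P
    by fact
  have "integrable P (\<lambda>w. muon_Cprev \<beta> Cm1 (Gb w) k)" for k
    by (induction k) (auto intro!: Gb Bochner_Integration.integrable_add integrable_scaleR_right)
  then show ?thesis
    unfolding muon_M_def muon_C_def
    by (intro Bochner_Integration.integrable_add integrable_scaleR_right Gb)
qed

section \<open>Muon with heavy-tailed noise\<close>

lemma inner_Basis_matrix:
  fixes b :: "real^'n^'m"
  assumes "b \<in> Basis"
  obtains i j where "\<And>x. x \<bullet> b = x $ i $ j"
proof -
  obtain i j where "b = axis i (axis j 1)"
    using assms by (auto simp: Basis_vec_def)
  then have "x \<bullet> b = x $ i $ j" for x
    by (simp add: inner_axis)
  then show ?thesis
    by (rule that)
qed

locale muon_heavy_tailed =
  muon f gradf fstar L \<eta> \<beta> d X0 Cm1 + prob_space P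
  for f :: "real^'n::finite^'m::finite \<Rightarrow> real" and gradf fstar L \<eta> \<beta> d X0 Cm1
    and P :: "'w measure" +
  fixes F :: "nat \<Rightarrow> 'w measure"
    and G :: "nat \<Rightarrow> nat \<Rightarrow> 'w \<Rightarrow> real^'n^'m"
    and B :: nat and \<alpha> \<sigma>0 \<sigma>1 :: real
  assumes B_pos: "0 < B"
    and \<alpha>: "1 < \<alpha>" "\<alpha> \<le> 2"
    and \<sigma>: "0 \<le> \<sigma>0" "0 \<le> \<sigma>1"
    and F_sub: "\<And>k. subalgebra P (F k)"
    and F_mono: "\<And>k. sets (F k) \<subseteq> sets (F (Suc k))"
    and G_meas: "\<And>k i. i \<in> {1..B} \<Longrightarrow> G k i \<in> borel_measurable (F (Suc k))"
    and G_indep: "\<And>k (A :: nat \<Rightarrow> (real^'n^'m) set). (\<And>i. A i \<in> sets borel) \<Longrightarrow>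
         AE w in P. real_cond_exp P (F k) (\<lambda>w. \<Prod>i\<in>{1..B}. indicator (A i) (G k i w)) w
                   = (\<Prod>i\<in>{1..B}. real_cond_exp P (F k) (\<lambda>w. indicator (A i) (G k i w)) w)"
    and G_unbiased: "\<And>k i a b. i \<in> {1..B} \<Longrightarrow>
         AE w in P. real_cond_exp P (F k) (\<lambda>w. G k i w $ a $ b) w
                   = gradf (muon_X \<eta> \<beta> X0 Cm1 (\<lambda>j. batch_mean G B j w) k) $ a $ b"
    and G_moment: "\<And>k i. i \<in> {1..B} \<Longrightarrow>
         AE w in P. nn_cond_exp P (F k)
             (\<lambda>w. ennreal (norm (G k i w
                 - gradf (muon_X \<eta> \<beta> X0 Cm1 (\<lambda>j. batch_mean G B j w) k)) powr \<alpha>)) w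
           \<le> ennreal (\<sigma>0 powr \<alpha>
               + \<sigma>1 powr \<alpha> * norm (gradf (muon_X \<eta> \<beta> X0 Cm1 (\<lambda>j. batch_mean G B j w) k)) powr \<alpha>)"
begin

abbreviation batch :: "'w \<Rightarrow> nat \<Rightarrow> real^'n^'m" where
  "batch w \<equiv> (\<lambda>j. batch_mean G B j w)"

sublocale heavy_tailed_batches P F G "\<lambda>k w. gradf (iterate (batch w) k)" B \<alpha> \<sigma>0 \<sigma>1
proof
  have "(\<lambda>w. batch w k) \<in> borel_measurable (F (Suc k))" for k
    unfolding batch_mean_def
    by (intro borel_measurable_scaleR borel_measurable_const borel_measurable_sum G_meas)
  then have "(\<lambda>w. iterate (batch w) k) \<in> borel_measurable (F k)" for k
    using F_sub F_mono by (intro borel_measurable_muon_X[where F = F])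
  then show "(\<lambda>w. gradf (iterate (batch w) k)) \<in> borel_measurable (F k)" for k
    using measurable_compose[OF _ borel_measurable_gradf] by blast
  show "\<exists>c. \<forall>w. norm (gradf (iterate (batch w) k)) \<le> c" for k
    using norm_gradf_iterate_le by blast
  show "AE w in P. real_cond_exp P (F k) (\<lambda>w. G k i w \<bullet> b) w = gradf (iterate (batch w) k) \<bullet> b"
    if "i \<in> {1..B}" "b \<in> Basis" for k i b
    using \<open>b \<in> Basis\<close> G_unbiased[OF \<open>i \<in> {1..B}\<close>] by (auto elim: inner_Basis_matrix)
qed (use \<alpha> \<sigma> F_sub F_mono G_meas G_indep G_moment in auto)

definition expected_gradient :: "nat \<Rightarrow> real" where
  "expected_gradient k = expectation (\<lambda>w. norm (gradf (iterate (batch w) k)))"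

definition expected_error :: "nat \<Rightarrow> real" where
  "expected_error k = expectation (\<lambda>w. norm (momentum_error (batch w) k))"

lemma expected_gradient_nonneg: "0 \<le> expected_gradient k"
  by (simp add: expected_gradient_def)

lemma expected_error_nonneg: "0 \<le> expected_error k"
  by (simp add: expected_error_def)

lemma integrable_momentum_error: "integrable P (\<lambda>w. momentum_error (batch w) k)"
proof -
  have "integrable P (\<lambda>w. batch w k)" for k
    unfolding batch_mean_def
    by (intro integrable_scaleR_right Bochner_Integration.integrable_sum integrable_G)
  then show ?thesis
    unfolding momentum_error_def
    by (intro Bochner_Integration.integrable_diff integrable_scaleR_right integrable_muon_M
        integrable_D finite_measure_axioms)
qed

lemma sum_expected_gradient_le:
  "\<eta> * (\<Sum>k<K. expected_gradient k)
    \<le> f X0 - fstar + \<eta> * (1 + sqrt d) * (\<Sum>k<K. expected_error k) + K * (L * d * \<eta>\<^sup>2 / 2)"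
proof -
  have "(\<integral>w. \<eta> * (\<Sum>k<K. norm (gradf (iterate (batch w) k))) \<partial>P)
      \<le> (\<integral>w. f X0 - fstar + \<eta> * (1 + sqrt d) * (\<Sum>k<K. norm (momentum_error (batch w) k))
        + K * (L * d * \<eta>\<^sup>2 / 2) \<partial>P)"
    using integrable_momentum_error integrable_D sum_norm_gradf_iterate_le
    by (intro integral_mono) auto
  then show ?thesis
    using integrable_momentum_error integrable_D
    by (simp add: expected_gradient_def expected_error_def prob_space)
qed

definition noise_floor :: real where
  "noise_floor = (2 powr \<alpha> + 1) powr (1/\<alpha>) * \<sigma>0 * (1 - \<beta>) powr ((\<alpha> - 1) / \<alpha>)"

definition weighted_gradient :: "nat \<Rightarrow> real" where
  "weighted_gradient k = (\<Sum>j<Suc k. (1 - \<beta>) * \<bar>muon_weight \<beta> k j\<bar> * expected_gradient j)"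

definition noise_coeff :: "nat \<Rightarrow> nat \<Rightarrow> real" where
  "noise_coeff k j = (1 - \<beta>) / B * muon_weight \<beta> k j"

lemma momentum_noise_eq_weighted_noise:
  "(1 - \<beta>) *\<^sub>R (\<Sum>j<Suc k. muon_weight \<beta> k j *\<^sub>R (batch w j - gradf (iterate (batch w) j)))
    = weighted_noise (noise_coeff k) (Suc k) w"
proof -
  have "batch w j - gradf (iterate (batch w) j) = (1 / B) *\<^sub>R (\<Sum>i\<in>{1..B}. noise j i w)" for j
    using B_pos by (simp add: batch_mean_def[of G B j w] noise_def sum_subtractf scaleR_diff_right
        sum_constant_scaleR del: sum_constant)
  then show ?thesis
    by (simp add: weighted_noise_def noise_coeff_def scaleR_add_right scaleR_sum_right[of "1 - \<beta>"])
qed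

lemma root_sum_noise_coeff_powr_le:
  "(\<Sum>j<Suc k. \<bar>noise_coeff k j\<bar> powr \<alpha>) powr (1/\<alpha>)
    \<le> (2 powr \<alpha> + 1) powr (1/\<alpha>) * (1 - \<beta>) powr ((\<alpha> - 1) / \<alpha>) / B"
proof -
  have "(\<Sum>j<Suc k. \<bar>noise_coeff k j\<bar> powr \<alpha>)
      = ((1 - \<beta>) / B) powr \<alpha> * (\<Sum>j<Suc k. \<bar>muon_weight \<beta> k j\<bar> powr \<alpha>)"
    unfolding sum_distrib_left using \<beta>
    by (intro sum.cong) (auto simp: noise_coeff_def abs_mult powr_mult powr_divide)
  also have "\<dots> \<le> ((1 - \<beta>) / B) powr \<alpha> * ((2 powr \<alpha> + 1) / (1 - \<beta>))"
    using \<beta> \<alpha> by (intro mult_left_mono sum_muon_weight_powr_le) auto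
  finally have "(\<Sum>j<Suc k. \<bar>noise_coeff k j\<bar> powr \<alpha>) powr (1/\<alpha>)
      \<le> (((1 - \<beta>) / B) powr \<alpha> * ((2 powr \<alpha> + 1) / (1 - \<beta>))) powr (1/\<alpha>)"
    using \<alpha> by (intro powr_mono2) (auto intro!: sum_nonneg add_nonneg_nonneg)
  also have "\<dots> = (1 - \<beta>) / B * ((2 powr \<alpha> + 1) powr (1/\<alpha>) / (1 - \<beta>) powr (1/\<alpha>))"
    using \<beta> \<alpha> by (simp add: powr_mult powr_divide powr_powr)
  also have "\<dots> = (2 powr \<alpha> + 1) powr (1/\<alpha>) * ((1 - \<beta>) / (1 - \<beta>) powr (1/\<alpha>)) / B"
    by (simp add: mult_ac)
  also have "(1 - \<beta>) / (1 - \<beta>) powr (1/\<alpha>) = (1 - \<beta>) powr ((\<alpha> - 1) / \<alpha>)"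
    using \<beta> \<alpha> by (simp add: diff_divide_distrib powr_diff)
  finally show ?thesis .
qed

lemma expectation_norm_momentum_noise_le:
  "expectation (\<lambda>w. norm (weighted_noise (noise_coeff k) (Suc k) w))
    \<le> 3 / B powr ((\<alpha> - 1) / \<alpha>) * (noise_floor + \<sigma>1 * weighted_gradient k)"
proof -
  have "expectation (\<lambda>w. norm (weighted_noise (noise_coeff k) (Suc k) w))
      \<le> 3 * B powr (1/\<alpha>) * (\<sigma>0 * (\<Sum>j<Suc k. \<bar>noise_coeff k j\<bar> powr \<alpha>) powr (1/\<alpha>)
        + \<sigma>1 * (\<Sum>j<Suc k. \<bar>noise_coeff k j\<bar> * expected_gradient j))"
    unfolding expected_gradient_def by (rule expectation_norm_weighted_noise_le)
  also have "\<dots> \<le> 3 * B powr (1/\<alpha>) * (noise_floor / B + \<sigma>1 * (weighted_gradient k / B))"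
  proof (intro mult_left_mono add_mono)
    show "\<sigma>0 * (\<Sum>j<Suc k. \<bar>noise_coeff k j\<bar> powr \<alpha>) powr (1/\<alpha>) \<le> noise_floor / B"
      using mult_left_mono[OF root_sum_noise_coeff_powr_le \<sigma>(1), of k]
      by (simp add: noise_floor_def mult_ac)
    show "(\<Sum>j<Suc k. \<bar>noise_coeff k j\<bar> * expected_gradient j) \<le> weighted_gradient k / B"
      using \<beta> by (simp add: noise_coeff_def weighted_gradient_def abs_mult sum_divide_distrib
          add_divide_distrib)
  qed (use \<sigma> in auto)
  also have "\<dots> = 3 * (B powr (1/\<alpha>) / B) * (noise_floor + \<sigma>1 * weighted_gradient k)"
    by (simp add: algebra_simps add_divide_distrib)
  also have "B powr (1/\<alpha>) / B = 1 / B powr ((\<alpha> - 1) / \<alpha>)"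
    using B_pos \<alpha> by (simp add: diff_divide_distrib powr_diff)
  finally show ?thesis
    by simp
qed

lemma expected_error_le:
  "expected_error k \<le> \<beta> ^ k * expected_error 0 + \<beta>\<^sup>2 * (L * \<eta> * sqrt d) / (1 - \<beta>)
    + 3 / B powr ((\<alpha> - 1) / \<alpha>) * (noise_floor + \<sigma>1 * weighted_gradient k)"
proof -
  have "expected_error k \<le> (\<integral>w. \<beta> ^ k * norm (momentum_error (batch w) 0)
      + \<beta>\<^sup>2 * (L * \<eta> * sqrt d) / (1 - \<beta>) + norm (weighted_noise (noise_coeff k) (Suc k) w) \<partial>P)"
    unfolding expected_error_def
    using integrable_momentum_error integrable_weighted_noise
      norm_momentum_error_le[of "batch _" k, unfolded momentum_noise_eq_weighted_noise]
    by (intro integral_mono) auto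
  also have "\<dots> = \<beta> ^ k * expected_error 0 + \<beta>\<^sup>2 * (L * \<eta> * sqrt d) / (1 - \<beta>)
      + expectation (\<lambda>w. norm (weighted_noise (noise_coeff k) (Suc k) w))"
    using integrable_momentum_error integrable_weighted_noise
    by (simp add: expected_error_def prob_space)
  finally show ?thesis
    using expectation_norm_momentum_noise_le[of k] by linarith
qed

lemma sum_weighted_gradient_le: "(\<Sum>k<K. weighted_gradient k) \<le> (\<Sum>j<K. expected_gradient j)"
proof -
  have "(\<Sum>k<K. weighted_gradient k) = (\<Sum>k<K. \<Sum>j<K. (1 - \<beta>) * \<bar>muon_weight \<beta> k j\<bar> * expected_gradient j)"
    unfolding weighted_gradient_def
    by (intro sum.cong refl sum.mono_neutral_left) (auto simp: muon_weight_eq)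
  also have "\<dots> = (\<Sum>j<K. \<Sum>k<K. (1 - \<beta>) * \<bar>muon_weight \<beta> k j\<bar> * expected_gradient j)"
    by (rule sum.swap)
  also have "\<dots> = (\<Sum>j<K. ((1 - \<beta>) * (\<Sum>k<K. \<bar>muon_weight \<beta> k j\<bar>)) * expected_gradient j)"
    by (simp add: sum_distrib_left sum_distrib_right)
  also have "\<dots> \<le> (\<Sum>j<K. 1 * expected_gradient j)"
    using \<beta> by (intro sum_mono mult_right_mono sum_muon_weight_column_le expected_gradient_nonneg)
  finally show ?thesis
    by simp
qed

lemma sum_expected_error_le:
  "(\<Sum>k<K. expected_error k) \<le> expected_error 0 / (1 - \<beta>) + K * (\<beta>\<^sup>2 * (L * \<eta> * sqrt d) / (1 - \<beta>))
    + 3 / B powr ((\<alpha> - 1) / \<alpha>) * (K * noise_floor + \<sigma>1 * (\<Sum>k<K. expected_gradient k))"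
proof -
  let ?drift = "\<beta>\<^sup>2 * (L * \<eta> * sqrt d) / (1 - \<beta>)" and ?\<kappa> = "3 / B powr ((\<alpha> - 1) / \<alpha>)"
  have "(\<Sum>k<K. expected_error k)
      \<le> (\<Sum>k<K. \<beta> ^ k * expected_error 0 + ?drift + ?\<kappa> * (noise_floor + \<sigma>1 * weighted_gradient k))"
    by (intro sum_mono expected_error_le)
  also have "\<dots> = (\<Sum>k<K. \<beta> ^ k) * expected_error 0 + K * ?drift
      + ?\<kappa> * (K * noise_floor + \<sigma>1 * (\<Sum>k<K. weighted_gradient k))"
    by (simp only: sum.distrib sum_distrib_left[symmetric] sum_distrib_right[symmetric] sum_constant
        card_lessThan)
  also have "\<dots> \<le> 1 / (1 - \<beta>) * expected_error 0 + K * ?drift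
      + ?\<kappa> * (K * noise_floor + \<sigma>1 * (\<Sum>k<K. expected_gradient k))"
    using geometric_sum_less[OF \<beta>, of "{..<K}"] sum_weighted_gradient_le \<sigma>
    by (intro add_mono mult_left_mono mult_right_mono expected_error_nonneg order_refl) auto
  finally show ?thesis
    by simp
qed

lemma sum_expected_gradient_le_of_noise_factor:
  assumes \<kappa>: "3 / B powr ((\<alpha> - 1) / \<alpha>) \<le> \<kappa>"
  shows "(1 - (1 + sqrt d) * \<kappa> * \<sigma>1) * (\<Sum>k<K. expected_gradient k)
    \<le> (f X0 - fstar) / \<eta> + K * (L * d * \<eta> / 2)
      + (1 + sqrt d) * (expected_error 0 / (1 - \<beta>) + K * (\<beta>\<^sup>2 * (L * \<eta> * sqrt d) / (1 - \<beta>))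
        + \<kappa> * (K * noise_floor))"
proof -
  define E where "E = (\<Sum>k<K. expected_gradient k)"
  have "0 \<le> E" "0 \<le> noise_floor"
    unfolding E_def noise_floor_def using \<sigma> by (auto intro: sum_nonneg expected_gradient_nonneg)
  then have "3 / B powr ((\<alpha> - 1) / \<alpha>) * (K * noise_floor + \<sigma>1 * E) \<le> \<kappa> * (K * noise_floor + \<sigma>1 * E)"
    using \<kappa> \<sigma> by (intro mult_right_mono) auto
  then have error: "(\<Sum>k<K. expected_error k) \<le> expected_error 0 / (1 - \<beta>)
      + K * (\<beta>\<^sup>2 * (L * \<eta> * sqrt d) / (1 - \<beta>)) + \<kappa> * (K * noise_floor + \<sigma>1 * E)"
    using sum_expected_error_le[of K, folded E_def] by linarith
  have "E \<le> (f X0 - fstar + \<eta> * (1 + sqrt d) * (\<Sum>k<K. expected_error k) + K * (L * d * \<eta>\<^sup>2 / 2)) / \<eta>"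
    using sum_expected_gradient_le[of K] \<eta> by (simp add: E_def pos_le_divide_eq mult.commute)
  also have "\<dots> = (f X0 - fstar) / \<eta> + K * (L * d * \<eta> / 2) + (1 + sqrt d) * (\<Sum>k<K. expected_error k)"
    using \<eta> by (simp add: field_simps power2_eq_square)
  finally show ?thesis
    using mult_left_mono[OF error, of "1 + sqrt d"] d_nonneg
    unfolding E_def[symmetric] by (simp add: algebra_simps)
qed

lemma Min_expected_gradient_le:
  assumes K: "1 \<le> K" and \<kappa>: "3 / B powr ((\<alpha> - 1) / \<alpha>) \<le> \<kappa>"
    and \<rho>_eq: "\<rho> = 1 - (1 + sqrt d) * \<kappa> * \<sigma>1" and \<rho>_pos: "0 < \<rho>"
  shows "Min (expected_gradient ` {..<K})
    \<le> (f X0 - fstar) / (\<eta> * \<rho> * K) + L * d * \<eta> / (2 * \<rho>)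
      + (1 + sqrt d) * expected_error 0 / ((1 - \<beta>) * K * \<rho>)
      + \<beta>\<^sup>2 / ((1 - \<beta>) * \<rho>) * L * \<eta> * sqrt d * (1 + sqrt d)
      + (1 + sqrt d) * \<kappa> / \<rho> * noise_floor"
proof -
  have "(\<Sum>k<K. Min (expected_gradient ` {..<K})) \<le> (\<Sum>k<K. expected_gradient k)"
    by (intro sum_mono Min_le) auto
  then have "\<rho> * (K * Min (expected_gradient ` {..<K})) \<le> \<rho> * (\<Sum>k<K. expected_gradient k)"
    using \<rho>_pos by (intro mult_left_mono) auto
  also note sum_expected_gradient_le_of_noise_factor[OF \<kappa>, of K, folded \<rho>_eq]
  finally have "Min (expected_gradient ` {..<K}) \<le> ((f X0 - fstar) / \<eta> + K * (L * d * \<eta> / 2)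
      + (1 + sqrt d) * (expected_error 0 / (1 - \<beta>) + K * (\<beta>\<^sup>2 * (L * \<eta> * sqrt d) / (1 - \<beta>))
        + \<kappa> * (K * noise_floor))) / (\<rho> * K)"
    using \<rho>_pos K by (simp add: pos_le_divide_eq mult_ac)
  also have "\<dots> = (f X0 - fstar) / (\<eta> * \<rho> * K) + L * d * \<eta> / (2 * \<rho>)
      + (1 + sqrt d) * expected_error 0 / ((1 - \<beta>) * K * \<rho>)
      + \<beta>\<^sup>2 / ((1 - \<beta>) * \<rho>) * L * \<eta> * sqrt d * (1 + sqrt d)
      + (1 + sqrt d) * \<kappa> / \<rho> * noise_floor"
  proof -
    have "real K \<noteq> 0" "\<rho> \<noteq> 0" "\<eta> \<noteq> 0" "1 - \<beta> \<noteq> 0"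
      using K \<rho>_pos \<eta> \<beta> by auto
    then show ?thesis
      by (simp add: divide_simps) (simp add: algebra_simps)
  qed
  finally show ?thesis .
qed

end

lemma divide_powr_less_one:
  fixes t b \<alpha> :: real
  assumes "0 \<le> t" "1 < \<alpha>" "t powr (\<alpha> / (\<alpha> - 1)) < b"
  shows "t / b powr ((\<alpha> - 1) / \<alpha>) < 1"
proof -
  have "(t powr (\<alpha> / (\<alpha> - 1))) powr ((\<alpha> - 1) / \<alpha>) < b powr ((\<alpha> - 1) / \<alpha>)"
    using assms by (intro powr_less_mono2) auto
  then have "t < b powr ((\<alpha> - 1) / \<alpha>)"
    using assms by (simp add: powr_powr)
  then show ?thesis
    using assms(1) by (simp add: divide_less_eq)
qed

theorem mainTheorem14:
  fixes f :: "real^'n::finite^'m::finite \<Rightarrow> real"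
    and gradf :: "real^'n^'m \<Rightarrow> real^'n^'m"
    and fstar L \<alpha> \<sigma>0 \<sigma>1 \<eta> \<beta> C\<alpha> \<rho> :: real
    and K B :: nat
    and X0 Cm1 :: "real^'n^'m"
    and P :: "'w measure"
    and F :: "nat \<Rightarrow> 'w measure"
    and G :: "nat \<Rightarrow> nat \<Rightarrow> 'w \<Rightarrow> real^'n^'m"
    and X :: "nat \<Rightarrow> 'w \<Rightarrow> real^'n^'m"
  assumes grad: "\<And>Y. (f has_derivative (\<lambda>H. gradf Y \<bullet> H)) (at Y)"
    and lower: "\<And>Y. f Y \<ge> fstar"
    and smooth: "\<And>Y Z. norm (gradf Y - gradf Z) \<le> L * norm (Y - Z)"
    and C\<alpha>_pos: "0 < C\<alpha>" and C\<alpha>_le: "C\<alpha> \<le> 2"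
    and C\<alpha>: "vbe_constant \<alpha> C\<alpha> TYPE('n) TYPE('m)"
    and \<alpha>: "1 < \<alpha>" "\<alpha> \<le> 2"
    and \<sigma>: "0 \<le> \<sigma>0" "0 \<le> \<sigma>1"
    and K: "1 \<le> K"
    and \<eta>: "0 < \<eta>"
    and \<beta>: "0 < \<beta>" "\<beta> < 1"
    and B: "real B > (2 * sqrt pi * (1 + sqrt (min CARD('m) CARD('n))) * C\<alpha> powr (1 / \<alpha>) * \<sigma>1)
                      powr (\<alpha> / (\<alpha> - 1))"
    and \<rho>_def: "\<rho> = 1 - (1 + sqrt (min CARD('m) CARD('n))) * 2 * sqrt pi * C\<alpha> powr (1 / \<alpha>) * \<sigma>1
                       / real B powr ((\<alpha> - 1) / \<alpha>)"
    and P: "prob_space P"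
    and F_sub: "\<And>k. subalgebra P (F k)"
    and F_mono: "\<And>k. sets (F k) \<subseteq> sets (F (Suc k))"
    and X_def: "X = (\<lambda>k w. muon_X \<eta> \<beta> X0 Cm1 (\<lambda>j. batch_mean G B j w) k)"
    and G_meas: "\<And>k i. i \<in> {1..B} \<Longrightarrow> G k i \<in> borel_measurable (F (Suc k))"
    and G_indep: "\<And>k (A :: nat \<Rightarrow> (real^'n^'m) set). (\<And>i. A i \<in> sets borel) \<Longrightarrow>
         AE w in P. real_cond_exp P (F k) (\<lambda>w. \<Prod>i\<in>{1..B}. indicator (A i) (G k i w)) w
                   = (\<Prod>i\<in>{1..B}. real_cond_exp P (F k) (\<lambda>w. indicator (A i) (G k i w)) w)"
    and G_unbiased: "\<And>k i a b. i \<in> {1..B} \<Longrightarrow>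
         AE w in P. real_cond_exp P (F k) (\<lambda>w. G k i w $ a $ b) w = gradf (X k w) $ a $ b"
    and G_moment: "\<And>k i. i \<in> {1..B} \<Longrightarrow>
         AE w in P. nn_cond_exp P (F k) (\<lambda>w. ennreal (norm (G k i w - gradf (X k w)) powr \<alpha>)) w
                   \<le> ennreal (\<sigma>0 powr \<alpha> + \<sigma>1 powr \<alpha> * norm (gradf (X k w)) powr \<alpha>)"
  shows "Min ((\<lambda>k. prob_space.expectation P (\<lambda>w. norm (gradf (X k w)))) ` {..<K})
    \<le> (f X0 - fstar) / (\<eta> * \<rho> * real K)
      + L * real (min CARD('m) CARD('n)) * \<eta> / (2 * \<rho>)
      + (1 + sqrt (min CARD('m) CARD('n)))
          * prob_space.expectation P
              (\<lambda>w. norm ((1 - \<beta>) *\<^sub>R muon_M \<beta> Cm1 (\<lambda>j. batch_mean G B j w) 0 - gradf X0))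
          / ((1 - \<beta>) * real K * \<rho>)
      + \<beta>\<^sup>2 / ((1 - \<beta>) * \<rho>) * L * \<eta> * sqrt (min CARD('m) CARD('n)) * (1 + sqrt (min CARD('m) CARD('n)))
      + (1 + sqrt (min CARD('m) CARD('n))) * (2 * sqrt pi * C\<alpha> powr (1 / \<alpha>))
          / (\<rho> * real B powr ((\<alpha> - 1) / \<alpha>))
          * (2 powr \<alpha> + 1) powr (1 / \<alpha>) * \<sigma>0 * (1 - \<beta>) powr ((\<alpha> - 1) / \<alpha>)
      + (1 + sqrt (min CARD('m) CARD('n))) * (2 * sqrt pi * C\<alpha> powr (1 / \<alpha>) * \<sigma>1 * norm (gradf X0))
          / (\<rho> * real B powr ((\<alpha> - 1) / \<alpha>) * real K)"
proof -
  define d where "d = real (min CARD('m) CARD('n))"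
  define \<kappa> where "\<kappa> = 2 * sqrt pi * C\<alpha> powr (1 / \<alpha>) / real B powr ((\<alpha> - 1) / \<alpha>)"
  interpret prob_space P by (rule P)
  have B_pos: "0 < B"
    using B by (metis le_less_trans of_nat_0_less_iff powr_ge_zero)
  interpret muon_heavy_tailed f gradf fstar L \<eta> \<beta> d X0 Cm1 P F G B \<alpha> \<sigma>0 \<sigma>1
    by unfold_locales (rule grad lower smooth \<eta> \<beta> d_def B_pos \<alpha> \<sigma> F_sub F_mono G_meas G_indep
      G_unbiased[unfolded X_def] G_moment[unfolded X_def] | assumption)+
  have \<rho>_eq: "\<rho> = 1 - (1 + sqrt d) * \<kappa> * \<sigma>1"
    by (simp add: \<rho>_def \<kappa>_def d_def)
  moreover have "2 * sqrt pi * (1 + sqrt d) * C\<alpha> powr (1 / \<alpha>) * \<sigma>1 / real B powr ((\<alpha> - 1) / \<alpha>) < 1"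
    using B \<alpha> \<sigma> d_nonneg by (intro divide_powr_less_one) (auto simp: d_def)
  ultimately have \<rho>_pos: "0 < \<rho>"
    by (simp add: \<kappa>_def algebra_simps)
  have \<kappa>_ge: "3 / real B powr ((\<alpha> - 1) / \<alpha>) \<le> \<kappa>"
    unfolding \<kappa>_def using three_le_vbe_constant[OF C\<alpha>] \<alpha> by (intro divide_right_mono) auto
  have "0 \<le> (1 + sqrt d) * (\<kappa> * \<sigma>1 * norm (gradf X0)) / (\<rho> * real K)"
    using \<rho>_pos \<sigma> d_nonneg by (simp add: \<kappa>_def)
  with Min_expected_gradient_le[OF K \<kappa>_ge \<rho>_eq \<rho>_pos] show ?thesis
    unfolding expected_gradient_def expected_error_def momentum_error_def noise_floor_def
      X_def d_def \<kappa>_def by (simp add: mult_ac)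
qed

end
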